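(* Let $h_k^{(\alpha)}=\tau_{k+1}^{(\alpha)}/\tau_k^{(\alpha)}$ for $k\ge0$, with the convention $1/h_{-1}^{(\alpha)}=0$, where $\tau_k^{(\alpha)}$ are the $\tau$-functions defined in the context. The equations $$\frac{h^{(\alpha)}_{k}}{h_{k-1}^{(\alpha+1)}}+\frac{h_{k}^{(\alpha+1)}}{h^{(\alpha)}_{k}}=\frac{h_{k+1}^{(\alpha-1)}}{h_{k}^{(\alpha)}}+\frac{h_{k}^{(\alpha)}}{h_{k}^{(\alpha-1)}},\qquad \alpha\in\mathbb{Z},\ k=0,1,2,\dots,$$ are equivalent to the $2Q$-system $$\big(\tau_k^{(\alpha)}\big)^2=\tau_{k}^{(\alpha-1)}\tau_{k}^{(\alpha+1)}-\tau_{k+1}^{(\alpha-1)}\tau_{k-1}^{(\alpha+1)},\qquad \alpha\in\mathbb{Z},\ k=0,1,2,\dots.$$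
   Context: Two-component Fock space. Let $e_0,e_1$ be the standard basis of $\mathbb{C}^2$ and $e_az^k$ ($a=0,1$, $k\in\mathbb{Z}$) the corresponding basis of $\mathbb{C}^2\otimes\mathbb{C}[z,z^{-1}]$. Let $v_0=e_0\wedge e_1\wedge e_0z\wedge e_1z\wedge e_0z^2\wedge\cdots$. Let $\psi^+_{a,(k)}$ be the wedging operator $\omega\mapsto e_az^k\wedge\omega$ and $\psi^-_{a,(k)}=i(e_az^{-k-1})$ the contraction operator, where $i(e_az^m)(e_az^m\wedge\beta)=\beta$ for $\beta$ a wedge of basis vectors not involving $e_az^m$, and $i(e_az^m)$ kills wedges of basis vectors not involving $e_az^m$. They satisfy $[\psi^+_{a,(k)},\psi^-_{b,(l)}]_+=\delta_{ab}\delta_{k+l,-1}$, all other anticommutators being $0$, and $\psi^\pm_{a,(k)}v_0=0$ for $k\ge0$. $F^{(2)}$ is the span of all vectors obtained from $v_0$ by finitely many such operators. A basis is given by the elementary wedges $M_1M_0v_0$, $M_a=M_a^+M_a^-$, where $M_a^\pm=\psi^\pm_{a,(k_1)}\cdots\psi^\pm_{a,(k_s)}$ with $k_1<\cdots<k_s\le-1$ ($s\ge 0$); $\langle\,,\rangle$ is the bilinear form for which the elementary wedges are orthonormal. Fields: $\psi_a^\pm(w)=\sum_{k\in\mathbb{Z}}\psi^\pm_{a,(k)}w^{-k-1}$. Fermionic translation operators: $Q_0,Q_1$ are the invertible operators on $F^{(2)}$ determined by $Q_av_0=\psi^+_{a,(-1)}v_0$, $\psi_a^\pm(w)Q_a=w^{\pm1}Q_a\psi_a^\pm(w)$,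 $\psi^\pm_a(w)Q_b=-Q_b\psi_a^\pm(w)$ and $Q_aQ_b=-Q_bQ_a$ for $a\ne b$. Put $T=Q_1Q_0^{-1}$. Series: $c_i$ ($i\in\mathbb{Z}$) are formal variables, $C(w)=\sum_{i\in\mathbb{Z}}c_iw^{-i-1}$, $C^{(\alpha)}(w)=(-1)^\alpha w^\alpha C(w)$ for $\alpha\in\mathbb{Z}$; $\mathrm{Res}_w$ is the coefficient of $w^{-1}$. $\tau$-functions: $g_C^{(\alpha)}=\exp\big(\mathrm{Res}_w C^{(\alpha)}(w)\psi_1^+(w)\psi_0^-(w)\big)$, acting on $F^{(2)}$ with values in formal series in the $c_i$ (the lift of the loop group element $\begin{bmatrix}1&0\\C^{(\alpha)}(z)&1\end{bmatrix}$), and $$\tau_k^{(\alpha)}=\langle T^kv_0,g_C^{(\alpha)}v_0\rangle,\qquad k,\alpha\in\mathbb{Z}.$$ One has $\tau_k^{(\alpha)}=0$ for $k<0$ and $\tau_0^{(\alpha)}=1$. The ratios $h_k^{(\alpha)}$ are taken in the fraction field of $\mathbb{C}[c_i]_{i\in\mathbb{Z}}$, in which the $\tau_k^{(\alpha)}$, $k\ge0$, are nonzero. *)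

theory Defs
  imports Complex_Main "HOL-Library.Poly_Mapping" "HOL-Library.Z2"
    "HOL-Computational_Algebra.Fraction_Field"
begin

section \<open>The Fock space\<close>

abbreviation lookup where "lookup \<equiv> Poly_Mapping.lookup"
abbreviation keys where "keys \<equiv> Poly_Mapping.keys"

type_synonym mode = "bit \<times> int"  \<comment> \<open>\<open>(a, k)\<close> stands for \<open>e\<^sub>a z\<^sup>k\<close>\<close>

text \<open>Position in the ordered basis \<open>\<dots>, e\<^sub>0, e\<^sub>1, e\<^sub>0z, e\<^sub>1z, \<dots>\<close>\<close>
definition mode_pos :: "mode \<Rightarrow> int" where
  "mode_pos x = 2 * snd x + (if fst x = 0 then 0 else 1)"

definition vac_modes :: "mode set" where
  "vac_modes = {x. 0 \<le> snd x}"

text \<open>A semi-infinite wedge of basis vectors, taken in increasing order, is given by the set of its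
  factors; it differs from \<open>v\<^sub>0\<close> in finitely many factors. Such wedges span \<open>F\<^sup>(\<^sup>2\<^sup>)\<close>, see \<open>fock_induct\<close>.\<close>
typedef wedge = "{S :: mode set. finite (sym_diff S vac_modes)}"
  morphisms factors Wedge
  by (intro exI[of _ vac_modes]) simp

type_synonym fock = "wedge \<Rightarrow>\<^sub>0 complex"

definition scale :: "complex \<Rightarrow> ('b \<Rightarrow>\<^sub>0 complex) \<Rightarrow> ('b \<Rightarrow>\<^sub>0 complex)" where
  "scale c v = Poly_Mapping.map ((*) c) v"

definition basis :: "wedge \<Rightarrow> fock" where
  "basis S = Poly_Mapping.single S 1"

definition v0 :: fock where
  "v0 = basis (Wedge vac_modes)"

definition lin_ext :: "(wedge \<Rightarrow> fock) \<Rightarrow> fock \<Rightarrow> fock" where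
  "lin_ext f v = (\<Sum>S\<in>keys v. scale (lookup v S) (f S))"

text \<open>The sign from moving \<open>x\<close> past the factors of \<open>S\<close> preceding it.\<close>
definition wsign :: "mode \<Rightarrow> mode set \<Rightarrow> complex" where
  "wsign x S = (-1) ^ card {s \<in> S. mode_pos s < mode_pos x}"

definition wedging :: "mode \<Rightarrow> fock \<Rightarrow> fock" where
  "wedging x = lin_ext (\<lambda>S. if x \<in> factors S then 0
     else scale (wsign x (factors S)) (basis (Wedge (insert x (factors S)))))"

definition contraction :: "mode \<Rightarrow> fock \<Rightarrow> fock" where
  "contraction x = lin_ext (\<lambda>S. if x \<in> factors S
     then scale (wsign x (factors S)) (basis (Wedge (factors S - {x}))) else 0)"

definition psip :: "bit \<Rightarrow> int \<Rightarrow> fock \<Rightarrow> fock" where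
  "psip a k = wedging (a, k)"

definition psim :: "bit \<Rightarrow> int \<Rightarrow> fock \<Rightarrow> fock" where
  "psim a k = contraction (a, - k - 1)"

text \<open>The bilinear (not sesquilinear) form; the elementary wedges are the \<^const>\<open>basis\<close> vectors up
  to sign, see \<open>elementary_wedges_orthonormal\<close> below.\<close>
definition pairing :: "fock \<Rightarrow> fock \<Rightarrow> complex" where
  "pairing u v = (\<Sum>S\<in>keys u. lookup u S * lookup v S)"

text \<open>A formal distribution in \<open>w\<close> is given by its coefficient function, \<open>n\<close> being the exponent of
  \<open>w\<close>: the coefficient of \<open>w\<^sup>n\<close> in \<open>\<psi>\<^sup>\<plusminus>\<^sub>a(w)\<close> is the mode \<open>- n - 1\<close>.\<close>
definition psip_field :: "bit \<Rightarrow> int \<Rightarrow> fock \<Rightarrow> fock" where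
  "psip_field a n = psip a (- n - 1)"

definition psim_field :: "bit \<Rightarrow> int \<Rightarrow> fock \<Rightarrow> fock" where
  "psim_field a n = psim a (- n - 1)"


section \<open>Translation operators\<close>

definition fermionic_translations :: "(bit \<Rightarrow> fock \<Rightarrow> fock) \<Rightarrow> bool" where
  "fermionic_translations Q \<longleftrightarrow>
     (\<forall>a. Vector_Spaces.linear scale scale (Q a) \<and> bij (Q a)) \<and>
     (\<forall>a. Q a v0 = psip a (-1) v0) \<and>
     (\<forall>a n v. psip_field a n (Q a v) = Q a (psip_field a (n - 1) v)) \<and>
     (\<forall>a n v. psim_field a n (Q a v) = Q a (psim_field a (n + 1) v)) \<and>
     (\<forall>a b n v. a \<noteq> b \<longrightarrow> psip_field a n (Q b v) = - Q b (psip_field a n v)) \<and>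
     (\<forall>a b n v. a \<noteq> b \<longrightarrow> psim_field a n (Q b v) = - Q b (psim_field a n v)) \<and>
     (\<forall>a b v. a \<noteq> b \<longrightarrow> Q a (Q b v) = - Q b (Q a v))"

text \<open>Well defined by \<open>fermionic_translations_ex1\<close> below.\<close>
definition Q_op :: "bit \<Rightarrow> fock \<Rightarrow> fock" where
  "Q_op = (THE Q. fermionic_translations Q)"

definition T_op :: "fock \<Rightarrow> fock" where
  "T_op = Q_op 1 \<circ> inv (Q_op 0)"

definition iterate_int :: "('b \<Rightarrow> 'b) \<Rightarrow> int \<Rightarrow> 'b \<Rightarrow> 'b" where
  "iterate_int f k = (if 0 \<le> k then f ^^ nat k else inv f ^^ nat (- k))"


section \<open>Formal series in the variables \<open>c\<^sub>i\<close>\<close>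

type_synonym monom = "int \<Rightarrow>\<^sub>0 nat"  \<comment> \<open>exponents of the \<open>c\<^sub>i\<close>\<close>
type_synonym cpoly = "monom \<Rightarrow>\<^sub>0 complex"
type_synonym fock_series = "monom \<Rightarrow> fock"

definition cvar :: "int \<Rightarrow> cpoly" where
  "cvar i = Poly_Mapping.single (Poly_Mapping.single i 1) 1"

text \<open>Coefficient of \<open>w\<^sup>n\<close> in \<open>C(w)\<close> and in \<open>C\<^sup>(\<^sup>\<alpha>\<^sup>)(w)\<close>\<close>
definition C_series :: "int \<Rightarrow> cpoly" where
  "C_series n = cvar (- n - 1)"

definition C_alpha :: "int \<Rightarrow> int \<Rightarrow> cpoly" where
  "C_alpha \<alpha> n = scale ((-1) powi \<alpha>) (C_series (n - \<alpha>))"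

definition const_series :: "fock \<Rightarrow> fock_series" where
  "const_series v m = (if m = 0 then v else 0)"

definition cmult :: "cpoly \<Rightarrow> fock_series \<Rightarrow> fock_series" where
  "cmult p v m = (\<Sum>(m1, m2) \<in> {(m1, m2). m1 + m2 = m}. scale (lookup p m1) (v m2))"

text \<open>\<open>Res\<^sub>w C\<^sup>(\<^sup>\<alpha>\<^sup>)(w) \<psi>\<^sub>1\<^sup>+(w) \<psi>\<^sub>0\<^sup>-(w)\<close>. The exponents of \<open>w\<close> in the three factors add up to \<open>-1\<close>; in
  each coefficient only finitely many terms are nonzero, see \<open>res_op_finite\<close>.\<close>
definition res_op :: "int \<Rightarrow> fock_series \<Rightarrow> fock_series" where
  "res_op \<alpha> v m = (\<Sum>(p, q).
     cmult (C_alpha \<alpha> (- 1 - p - q)) (\<lambda>m'. psip_field 1 p (psim_field 0 q (v m'))) m)"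

text \<open>\<open>g\<^sub>C\<^sup>(\<^sup>\<alpha>\<^sup>)\<close>; the exponential sum is finite in each coefficient, see \<open>g_op_finite\<close>.\<close>
definition g_op :: "int \<Rightarrow> fock_series \<Rightarrow> fock_series" where
  "g_op \<alpha> v m = (\<Sum>n. scale (1 / fact n) ((res_op \<alpha> ^^ n) v m))"

text \<open>A polynomial by \<open>tau_finite\<close>; the arguments are \<open>\<alpha>\<close> and \<open>k\<close>.\<close>
definition tau :: "int \<Rightarrow> int \<Rightarrow> cpoly" where
  "tau \<alpha> k = Poly_Mapping.Abs_poly_mapping
     (\<lambda>m. pairing (iterate_int T_op k v0) (g_op \<alpha> (const_series v0) m))"

definition h_ratio :: "int \<Rightarrow> int \<Rightarrow> cpoly fract" where
  "h_ratio \<alpha> k = Fract (tau \<alpha> (k + 1)) (tau \<alpha> k)"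

definition inv_h_ratio :: "int \<Rightarrow> int \<Rightarrow> cpoly fract" where
  "inv_h_ratio \<alpha> k = (if k = - 1 then 0 else 1 / h_ratio \<alpha> k)"


section \<open>Well-definedness\<close>

lemma lookup_scale [simp]: "lookup (scale c v) S = c * lookup v S"
  by (simp add: scale_def Poly_Mapping.map.rep_eq when_def)

lemma vector_space_scale: "vector_space (scale :: complex \<Rightarrow> ('b \<Rightarrow>\<^sub>0 complex) \<Rightarrow> _)"
  by standard (auto intro!: poly_mapping_eqI simp: lookup_add algebra_simps)

lemma scale_simps [simp]:
  "scale 0 v = 0" "scale c 0 = 0" "scale 1 v = v" "scale a (scale b v) = scale (a * b) v"
  "scale c (- v) = - scale c v" "scale (- c) v = - scale c v"
  by (auto intro!: poly_mapping_eqI)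

lemma scale_add: "scale c (u + v) = scale c u + scale c v"
  by (auto intro!: poly_mapping_eqI simp: lookup_add algebra_simps)

lemma scale_add_left: "scale (a + b) v = scale a v + scale b v"
  by (auto intro!: poly_mapping_eqI simp: lookup_add algebra_simps)

lemma scale_sum: "scale c (sum f A) = (\<Sum>x\<in>A. scale c (f x))"
  by (induction A rule: infinite_finite_induct) (auto simp: scale_add)

lemma lookup_basis: "lookup (basis S) R = (if R = S then 1 else 0)"
  by (simp add: basis_def lookup_single when_def)

lemma keys_basis [simp]: "keys (basis S) = {S}"
  by (simp add: basis_def)

lemma linear_scaleI:
  fixes f :: "fock \<Rightarrow> fock"
  assumes "\<And>u v. f (u + v) = f u + f v" "\<And>c v. f (scale c v) = scale c (f v)"
  shows "Vector_Spaces.linear scale scale f"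
  using assms by (simp add: Vector_Spaces.linear_iff vector_space_scale)

lemma linear_scaleD:
  assumes "Vector_Spaces.linear scale scale f"
  shows "f (u + v) = f u + f v" "f (scale c v) = scale c (f v)" "f 0 = 0" "f (- v) = - f v"
    "f (u - v) = f u - f v" "f (sum g A) = (\<Sum>x\<in>A. f (g x))"
proof -
  interpret Vector_Spaces.linear scale scale f by fact
  show "f (u + v) = f u + f v" "f (scale c v) = scale c (f v)" "f 0 = 0" "f (- v) = - f v"
    "f (u - v) = f u - f v" "f (sum g A) = (\<Sum>x\<in>A. f (g x))"
    by (auto simp: add scale zero neg diff sum)
qed

lemma basis_expansion: "v = (\<Sum>S\<in>keys v. scale (lookup v S) (basis S))"
  by (rule poly_mapping_eqI)
    (auto simp: lookup_sum lookup_basis in_keys_iff if_distrib cong: if_cong)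

lemma lin_ext_superset:
  assumes "finite A" "keys v \<subseteq> A"
  shows "lin_ext f v = (\<Sum>S\<in>A. scale (lookup v S) (f S))"
  unfolding lin_ext_def
  by (rule sum.mono_neutral_left) (use assms in \<open>auto simp: in_keys_iff\<close>)

lemma linear_lin_ext: "Vector_Spaces.linear scale scale (lin_ext f)"
proof (rule linear_scaleI)
  fix u v :: fock
  have "keys (u + v) \<subseteq> keys u \<union> keys v" by (rule keys_add)
  then show "lin_ext f (u + v) = lin_ext f u + lin_ext f v"
    using lin_ext_superset[of "keys u \<union> keys v" _ f]
    by (simp add: lookup_add sum.distrib scale_add_left)
next
  fix c and v :: fock
  have "keys (scale c v) \<subseteq> keys v" by (auto simp: in_keys_iff)
  then show "lin_ext f (scale c v) = scale c (lin_ext f v)"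
    using lin_ext_superset[of "keys v" _ f] by (auto simp: scale_sum)
qed

lemma lin_ext_basis [simp]: "lin_ext f (basis S) = f S"
  by (simp add: lin_ext_def lookup_basis)

lemma linear_eqI:
  assumes "Vector_Spaces.linear scale scale f" "Vector_Spaces.linear scale scale g"
    "\<And>S. f (basis S) = g (basis S)"
  shows "f v = g v"
  by (subst (1 2) basis_expansion) (simp add: assms linear_scaleD)

lemma linear_compose':
  fixes f g :: "fock \<Rightarrow> fock"
  assumes "Vector_Spaces.linear scale scale f" "Vector_Spaces.linear scale scale g"
  shows "Vector_Spaces.linear scale scale (\<lambda>v. f (g v))"
  using assms by (intro linear_scaleI) (auto simp: linear_scaleD)

lemma linear_uminus':
  fixes f g :: "fock \<Rightarrow> fock"
  assumes "Vector_Spaces.linear scale scale f"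
  shows "Vector_Spaces.linear scale scale (\<lambda>v. - f v)"
  using assms by (intro linear_scaleI) (auto simp: linear_scaleD)

lemma linear_add':
  fixes f g :: "fock \<Rightarrow> fock"
  assumes "Vector_Spaces.linear scale scale f" "Vector_Spaces.linear scale scale g"
  shows "Vector_Spaces.linear scale scale (\<lambda>v. f v + g v)"
  using assms by (intro linear_scaleI) (auto simp: linear_scaleD scale_add)

lemma linear_wedging: "Vector_Spaces.linear scale scale (wedging x)"
  and linear_contraction: "Vector_Spaces.linear scale scale (contraction x)"
  unfolding wedging_def contraction_def by (rule linear_lin_ext)+

lemma linear_psip: "Vector_Spaces.linear scale scale (psip a k)"
  and linear_psim: "Vector_Spaces.linear scale scale (psim a k)"
  unfolding psip_def psim_def by (rule linear_wedging linear_contraction)+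

subsection \<open>Wedges as sets\<close>

definition adm :: "mode set \<Rightarrow> bool" where
  "adm S \<longleftrightarrow> finite (sym_diff S vac_modes)"

lemma adm_factors [simp]: "adm (factors W)"
  using factors[of W] by (simp add: adm_def)

lemma factors_Wedge [simp]: "adm S \<Longrightarrow> factors (Wedge S) = S"
  by (simp add: Wedge_inverse adm_def)

lemma Wedge_factors [simp]: "Wedge (factors W) = W"
  by (rule factors_inverse)

lemma Wedge_inject': "adm S \<Longrightarrow> adm S' \<Longrightarrow> Wedge S = Wedge S' \<longleftrightarrow> S = S'"
  by (simp add: Wedge_inject adm_def)

lemma adm_vac [simp]: "adm vac_modes"
  by (simp add: adm_def)

lemma adm_insert [simp]: "adm (insert x S) \<longleftrightarrow> adm S"
proof -
  have "sym_diff (insert x S) vac_modes \<subseteq> insert x (sym_diff S vac_modes)"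
       "sym_diff S vac_modes \<subseteq> insert x (sym_diff (insert x S) vac_modes)" by auto
  then show ?thesis unfolding adm_def by (meson finite_insert finite_subset)
qed

lemma adm_Diff [simp]: "adm (S - {x}) \<longleftrightarrow> adm S"
  by (metis adm_insert insert_Diff_single)

definition bw :: "mode set \<Rightarrow> fock" where "bw S = basis (Wedge S)"

lemma bw_factors: "basis W = bw (factors W)"
  by (simp add: bw_def)

lemma v0_bw: "v0 = bw vac_modes" by (simp add: v0_def bw_def)

lemma wedging_bw: "adm S \<Longrightarrow> wedging x (bw S) = (if x \<in> S then 0 else scale (wsign x S) (bw (insert x S)))"
  by (simp add: wedging_def bw_def)

lemma contraction_bw: "adm S \<Longrightarrow> contraction x (bw S) = (if x \<in> S then scale (wsign x S) (bw (S - {x})) else 0)"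
  by (simp add: contraction_def bw_def)

lemma linear_bw_eqI:
  assumes "Vector_Spaces.linear scale scale f" "Vector_Spaces.linear scale scale g"
    "\<And>S. adm S \<Longrightarrow> f (bw S) = g (bw S)"
  shows "f v = g v"
  by (rule linear_eqI) (use assms in \<open>auto simp: bw_factors\<close>)

lemma finite_below: "adm S \<Longrightarrow> finite {s \<in> S. mode_pos s < n}"
proof -
  assume "adm S"
  have "{s \<in> S. mode_pos s < n} \<subseteq> sym_diff S vac_modes \<union> (UNIV \<times> {0..n})"
    by (auto simp: mode_pos_def vac_modes_def)
  moreover have "finite (UNIV \<times> {0..n} :: mode set)"
  proof -
    have "(UNIV::bit set) = {0,1}" by auto
    then show ?thesis by (metis finite.simps finite_SigmaI finite_atLeastAtMost_int)
  qed
  ultimately show ?thesis using \<open>adm S\<close> unfolding adm_def by (meson finite_UnI finite_subset)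
qed

lemma mode_pos_inj: "mode_pos x = mode_pos y \<longleftrightarrow> x = y"
  by (auto simp: mode_pos_def prod_eq_iff split: if_splits; presburger)

lemma wsign_sq [simp]: "wsign x S * wsign x S = 1"
  by (simp add: wsign_def flip: power_add power_mult_distrib)

lemma wsign_insert: 
  assumes "adm S" "y \<notin> S"
  shows "wsign x (insert y S) = (if mode_pos y < mode_pos x then - wsign x S else wsign x S)"
proof (cases "mode_pos y < mode_pos x")
  case True
  then have "{s \<in> insert y S. mode_pos s < mode_pos x} = insert y {s \<in> S. mode_pos s < mode_pos x}"
    by auto
  with True assms finite_below[of S "mode_pos x"] show ?thesis by (simp add: wsign_def)
next
  case False
  then have "{s \<in> insert y S. mode_pos s < mode_pos x} = {s \<in> S. mode_pos s < mode_pos x}"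
    by auto
  with False show ?thesis by (simp add: wsign_def)
qed

lemma wsign_remove: 
  assumes "adm S" "y \<in> S"
  shows "wsign x (S - {y}) = (if mode_pos y < mode_pos x then - wsign x S else wsign x S)"
  using wsign_insert[of "S - {y}" y x] assms by (auto simp: insert_absorb)

lemma wedging_anticomm: "wedging x (wedging y v) = - wedging y (wedging x v)"
  by (rule linear_bw_eqI[OF linear_compose'[OF linear_wedging linear_wedging]
        linear_uminus'[OF linear_compose'[OF linear_wedging linear_wedging]]])
    (auto simp: wedging_bw linear_scaleD[OF linear_wedging] wsign_insert mode_pos_inj insert_commute
      not_less_iff_gr_or_eq mult.commute)

lemma contraction_anticomm: "contraction x (contraction y v) = - contraction y (contraction x v)"
  by (rule linear_bw_eqI[OF linear_compose'[OF linear_contraction linear_contraction]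
        linear_uminus'[OF linear_compose'[OF linear_contraction linear_contraction]]])
    (auto simp: contraction_bw linear_scaleD[OF linear_contraction] wsign_remove mode_pos_inj Diff_insert2[symmetric]
      insert_commute  not_less_iff_gr_or_eq mult.commute)

lemma linear_ident': "Vector_Spaces.linear scale scale (\<lambda>v::fock. v)" 
  and linear_zero': "Vector_Spaces.linear scale scale (\<lambda>v::fock. 0::fock)"
  by (auto intro!: linear_scaleI)

lemma wedging_contraction:
  "wedging x (contraction y v) + contraction y (wedging x v) = (if x = y then v else 0)"
proof -
  have lin: "Vector_Spaces.linear scale scale (\<lambda>v. wedging x (contraction y v) + contraction y (wedging x v))"
    by (rule linear_add'[OF linear_compose'[OF linear_wedging linear_contraction]
          linear_compose'[OF linear_contraction linear_wedging]])
  note s = wedging_bw contraction_bw linear_scaleD[OF linear_contraction] linear_scaleD[OF linear_wedging]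
     wsign_remove wsign_insert insert_absorb
  show ?thesis
  proof (cases "x = y")
    case True
    then show ?thesis
      using linear_bw_eqI[OF lin linear_ident', of v] by (auto simp: s)
  next
    case False
    have *: "insert x (S - {y}) = insert x S - {y}" for S using False by auto
    have "mode_pos x \<noteq> mode_pos y" using False mode_pos_inj by auto
    then show ?thesis using False
      using linear_bw_eqI[OF lin linear_zero', of v] by (auto simp: s * mult.commute)
  qed
qed

lemma psip_psip: "psip a k (psip b l v) = - psip b l (psip a k v)"
  and psim_psim: "psim a k (psim b l v) = - psim b l (psim a k v)"
  and psip_psim: "psip a k (psim b l v) + psim b l (psip a k v) = (if a = b \<and> k + l = -1 then v else 0)"
  unfolding psip_def psim_def
  by (rule wedging_anticomm contraction_anticomm, rule wedging_anticomm contraction_anticomm,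
      subst wedging_contraction, auto)

lemma psi_v0: "0 \<le> k \<Longrightarrow> psip a k v0 = 0" "0 \<le> k \<Longrightarrow> psim a k v0 = 0"
  by (auto simp: v0_bw psip_def psim_def wedging_bw contraction_bw) (auto simp: vac_modes_def)

text \<open>\<open>F\<^sup>(\<^sup>2\<^sup>)\<close> is generated by \<open>v\<^sub>0\<close>.\<close>
lemma fock_induct [case_names v0 add scale psip psim]:
  assumes "P v0" "\<And>u v. P u \<Longrightarrow> P v \<Longrightarrow> P (u + v)" "\<And>c v. P v \<Longrightarrow> P (scale c v)"
    "\<And>a k v. P v \<Longrightarrow> P (psip a k v)" "\<And>a k v. P v \<Longrightarrow> P (psim a k v)"
  shows "P v"
proof -
  have w: "P (wedging x v)" if "P v" for x v using assms(4)[OF that, of "fst x" "snd x"] 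
    by (simp add: psip_def)
  have c: "P (contraction x v)" if "P v" for x v using assms(5)[OF that, of "fst x" "- snd x - 1"] 
    by (simp add: psim_def)
  have z: "P 0" using assms(3)[OF assms(1), of 0] by simp
  have bwP: "P (bw S)" if "adm S" for S
    using that
  proof (induction "card (sym_diff S vac_modes)" arbitrary: S)
    case 0
    then have "S = vac_modes" unfolding adm_def by (auto simp: card_eq_0_iff)
    then show ?case using assms(1) by (simp add: v0_bw)
  next
    case (Suc n)
    then obtain x where x: "x \<in> sym_diff S vac_modes"
      by (metis card.empty ex_in_conv nat.distinct(1))
    show ?case
    proof (cases "x \<in> S")
      case True
      with x have "sym_diff (S - {x}) vac_modes = sym_diff S vac_modes - {x}" by auto
      with x Suc(2,3) have "n = card (sym_diff (S - {x}) vac_modes)" by (simp add: adm_def)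
      then have "P (bw (S - {x}))" using Suc by simp
      then have "P (scale (wsign x (S - {x})) (wedging x (bw (S - {x}))))" by (intro assms(3) w)
      with True Suc(3) show ?thesis
        by (simp add: wedging_bw insert_absorb)
    next
      case False
      with x have "sym_diff (insert x S) vac_modes = sym_diff S vac_modes - {x}" by auto
      with x Suc(2,3) have "n = card (sym_diff (insert x S) vac_modes)" by (simp add: adm_def)
      then have "P (bw (insert x S))" using Suc by simp
      then have "P (scale (wsign x (insert x S)) (contraction x (bw (insert x S))))" by (intro assms(3) c)
      with False Suc(3) show ?thesis
        by (simp add: contraction_bw)
    qed
  qed
  have "P (\<Sum>S\<in>A. scale (lookup v S) (basis S))" for A
    by (induction A rule: infinite_finite_induct) (simp_all add: z assms(2,3) bwP bw_factors)
  then show ?thesis by (subst basis_expansion)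
qed

subsection \<open>Existence and uniqueness of the translation operators\<close>

definition shift_mode :: "bit \<Rightarrow> mode \<Rightarrow> mode" where
  "shift_mode a x = (fst x, if fst x = a then snd x - 1 else snd x)"

definition unshift_mode :: "bit \<Rightarrow> mode \<Rightarrow> mode" where
  "unshift_mode a x = (fst x, if fst x = a then snd x + 1 else snd x)"

lemma sh_shi [simp]: "shift_mode a (unshift_mode a x) = x" "unshift_mode a (shift_mode a x) = x"
  by (auto simp: shift_mode_def unshift_mode_def)

lemma inj_sh [simp]: "inj_on (shift_mode a) S" "inj_on (unshift_mode a) S"
  by (metis inj_onI sh_shi)+

lemma sh_mem_image [simp]: "shift_mode a x \<in> shift_mode a ` S \<longleftrightarrow> x \<in> S"
  by (metis image_iff sh_shi(2))

lemma sh_image_shi [simp]: "shift_mode a ` unshift_mode a ` S = S" "unshift_mode a ` shift_mode a ` S = S"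
  by (simp_all add: image_image)

lemma sh_vac: "shift_mode a ` vac_modes = insert (a, -1) vac_modes"
proof (intro equalityI subsetI)
  fix x assume "x \<in> insert (a, -1) vac_modes"
  then have "unshift_mode a x \<in> vac_modes" by (auto simp: unshift_mode_def vac_modes_def)
  then show "x \<in> shift_mode a ` vac_modes" by (metis imageI sh_shi(1))
qed (auto simp: shift_mode_def vac_modes_def split: if_splits)

lemma shi_vac: "unshift_mode a ` vac_modes = vac_modes - {(a, 0)}"
proof (intro equalityI subsetI)
  fix x assume "x \<in> vac_modes - {(a, 0)}"
  then have "shift_mode a x \<in> vac_modes" by (cases x) (auto simp: shift_mode_def vac_modes_def)
  then show "x \<in> unshift_mode a ` vac_modes" by (metis imageI sh_shi(2))
qed (auto simp: unshift_mode_def vac_modes_def)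

lemma adm_image:
  assumes "adm S" "adm (f ` vac_modes)" "inj f"
  shows "adm (f ` S)"
proof -
  have "sym_diff (f ` S) vac_modes \<subseteq> f ` sym_diff S vac_modes \<union> sym_diff (f ` vac_modes) vac_modes"
    by auto
  then show ?thesis using assms unfolding adm_def by (meson finite_UnI finite_imageI finite_subset)
qed

lemma adm_sh [simp]: "adm S \<Longrightarrow> adm (shift_mode a ` S)" "adm S \<Longrightarrow> adm (unshift_mode a ` S)"
  using adm_image[of S "shift_mode a"] adm_image[of S "unshift_mode a"] by (simp_all add: sh_vac shi_vac)

definition tset :: "bit \<Rightarrow> mode set \<Rightarrow> int set" where
  "tset a S = {k. (a + 1, k) \<in> S \<and> (a, k + (if a = 0 then 1 else 0)) \<notin> S}"

definition tsign :: "bit \<Rightarrow> mode set \<Rightarrow> complex" where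
  "tsign a S = (-1) ^ card (tset a S)"

lemma finite_tset: 
  assumes "adm S"
  shows "finite (tset a S)"
proof -
  let ?d = "if a = 0 then 1 else 0 :: int"
  have "tset a S \<subseteq> snd ` sym_diff S vac_modes \<union> (\<lambda>x. snd x - ?d) ` sym_diff S vac_modes"
  proof
    fix k assume k: "k \<in> tset a S"
    show "k \<in> snd ` sym_diff S vac_modes \<union> (\<lambda>x. snd x - ?d) ` sym_diff S vac_modes"
    proof (cases "k < 0")
      case True
      with k have "(a + 1, k) \<in> sym_diff S vac_modes" by (auto simp: tset_def vac_modes_def)
      then show ?thesis by force
    next
      case False
      with k have "(a, k + ?d) \<in> sym_diff S vac_modes" by (auto simp: tset_def vac_modes_def)
      then have "k \<in> (\<lambda>x. snd x - ?d) ` sym_diff S vac_modes" by (rule rev_image_eqI) simp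
      then show ?thesis by blast
    qed
  qed
  then show ?thesis using assms unfolding adm_def by (meson finite_UnI finite_imageI finite_subset)
qed

lemma minus1_card_insert: "finite X \<Longrightarrow> z \<notin> X \<Longrightarrow> (-1::complex) ^ card (insert z X) = - ((-1) ^ card X)"
  by simp

lemma minus1_card_remove: "finite X \<Longrightarrow> z \<in> X \<Longrightarrow> (-1::complex) ^ card (X - {z}) = - ((-1) ^ card X)"
  using minus1_card_insert[of "X - {z}" z] by (simp add: insert_absorb)

definition bsh :: "bit \<Rightarrow> mode \<Rightarrow> mode set \<Rightarrow> mode set" where
  "bsh a x S = {s \<in> S. mode_pos (shift_mode a s) < mode_pos (shift_mode a x)}"

lemma wsign_sh: "wsign (shift_mode a x) (shift_mode a ` S) = (-1) ^ card (bsh a x S)"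
proof -
  have "{s \<in> shift_mode a ` S. mode_pos s < mode_pos (shift_mode a x)} = shift_mode a ` bsh a x S"
    by (auto simp: bsh_def)
  then show ?thesis unfolding wsign_def by (simp only: card_image[OF inj_sh(1)])
qed

lemma mode_ex: "\<exists>j. x = (0, j) \<or> x = (1, j)" for x :: mode
  by (cases x; cases "fst x") auto

lemma sign_key:
  assumes S: "adm S" and x: "x \<notin> S"
  shows "wsign (shift_mode a x) (shift_mode a ` S) * tsign a S
       = (if fst x = a then 1 else -1) * tsign a (insert x S) * wsign x S"
proof -
  let ?R = "{s \<in> S. mode_pos s < mode_pos x}" and ?L = "bsh a x S"
  have finR: "finite ?R" using finite_below[OF S] .
  have "finite {s \<in> shift_mode a ` S. mode_pos s < mode_pos (shift_mode a x)}" using finite_below[OF adm_sh(1)[OF S]] .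
  moreover have "{s \<in> shift_mode a ` S. mode_pos s < mode_pos (shift_mode a x)} = shift_mode a ` ?L"
    by (auto simp: bsh_def)
  ultimately have finL: "finite ?L" by (simp add: finite_image_iff)
  have finA: "finite (tset a S)" by (rule finite_tset[OF S])
  obtain j where j: "x = (0, j) \<or> x = (1, j)" using mode_ex by blast
  note d = bsh_def mode_pos_def shift_mode_def tset_def
  have memI: "s = (0, snd s) \<or> s = (1, snd s)" for s :: mode by (cases s; cases "fst s") auto
  have rem: ?thesis
    if "fst x = a" "\<And>s. s \<in> ?R \<longleftrightarrow> s \<in> ?L \<or> s = y \<and> y \<in> S" "y \<notin> ?L"
      "tset a (insert x S) = tset a S - {i}" "i \<in> tset a S \<longleftrightarrow> y \<in> S" for y i
  proof (cases "y \<in> S")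
    case True
    then have "?R = insert y ?L" using that(2) by blast
    then have "(-1) ^ card ?R = - ((-1::complex) ^ card ?L)"
      using minus1_card_insert[OF finL that(3)] by simp
    then show ?thesis using True that minus1_card_remove[OF finA, of i]
      unfolding wsign_sh by (simp add: wsign_def tsign_def)
  next
    case False
    then have "?R = ?L" using that(2) by blast
    then show ?thesis using False that unfolding wsign_sh by (simp add: wsign_def tsign_def)
  qed
  have ins: ?thesis
    if "fst x \<noteq> a" "\<And>s. s \<in> ?L \<longleftrightarrow> s \<in> ?R \<or> s = y \<and> y \<in> S" "y \<notin> ?R"
      "tset a (insert x S) = (if y \<in> S then tset a S else insert i (tset a S))" "i \<notin> tset a S" for y i
  proof (cases "y \<in> S")
    case True
    then have "?L = insert y ?R" using that(2) by blast
    then have "(-1) ^ card ?L = - ((-1::complex) ^ card ?R)"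
      using minus1_card_insert[OF finR that(3)] by simp
    then show ?thesis using True that 
      unfolding wsign_sh by (simp add: wsign_def tsign_def)
  next
    case False
    then have "?R = ?L" using that(2) by blast
    then show ?thesis using False that minus1_card_insert[OF finA, of i]
      unfolding wsign_sh by (simp add: wsign_def tsign_def)
  qed
  consider "a = 0" "x = (0, j)" | "a = 0" "x = (1, j)" | "a = 1" "x = (1, j)" | "a = 1" "x = (0, j)"
    using j by (cases a) auto
  then show ?thesis
  proof cases
    case 1
    show ?thesis
    proof (rule rem[of "(1, j - 1)" "j - 1"])
      show "s \<in> ?R \<longleftrightarrow> s \<in> ?L \<or> s = (1, j - 1) \<and> (1, j - 1) \<in> S" for s
        using memI[of s] 1 x by (cases s; cases "snd s = j - 1") (auto simp: d)
    qed (use 1 x in \<open>auto simp: d\<close>)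
  next
    case 2
    show ?thesis
    proof (rule ins[of "(0, j + 1)" "j"])
      show "s \<in> ?L \<longleftrightarrow> s \<in> ?R \<or> s = (0, j + 1) \<and> (0, j + 1) \<in> S" for s
        using memI[of s] 2 x by (cases s; cases "snd s = j + 1") (auto simp: d)
    qed (use 2 x in \<open>auto simp: d\<close>)
  next
    case 3
    show ?thesis
    proof (rule rem[of "(0, j)" "j"])
      show "s \<in> ?R \<longleftrightarrow> s \<in> ?L \<or> s = (0, j) \<and> (0, j) \<in> S" for s
        using memI[of s] 3 x by (cases s; cases "snd s = j") (auto simp: d)
    qed (use 3 x in \<open>auto simp: d\<close>)
  next
    case 4
    show ?thesis
    proof (rule ins[of "(1, j)" "j"])
      show "s \<in> ?L \<longleftrightarrow> s \<in> ?R \<or> s = (1, j) \<and> (1, j) \<in> S" for s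
        using memI[of s] 4 x by (cases s; cases "snd s = j") (auto simp: d)
    qed (use 4 x in \<open>auto simp: d\<close>)
  qed
qed

definition transl :: "bit \<Rightarrow> fock \<Rightarrow> fock" where
  "transl a = lin_ext (\<lambda>W. scale (tsign a (factors W)) (bw (shift_mode a ` factors W)))"

definition transl_inv :: "bit \<Rightarrow> fock \<Rightarrow> fock" where
  "transl_inv a = lin_ext (\<lambda>W. scale (tsign a (unshift_mode a ` factors W)) (bw (unshift_mode a ` factors W)))"

lemma linear_tr: "Vector_Spaces.linear scale scale (transl a)"
  and linear_tri: "Vector_Spaces.linear scale scale (transl_inv a)"
  unfolding transl_def transl_inv_def by (rule linear_lin_ext)+

lemma tr_bw: "adm S \<Longrightarrow> transl a (bw S) = scale (tsign a S) (bw (shift_mode a ` S))"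
  and tri_bw: "adm S \<Longrightarrow> transl_inv a (bw S) = scale (tsign a (unshift_mode a ` S)) (bw (unshift_mode a ` S))"
  by (simp_all add: transl_def transl_inv_def bw_def[of S])

lemma tsign_sq [simp]: "tsign a S * tsign a S = 1"
  by (simp add: tsign_def flip: power_add power_mult_distrib)

lemma bij_tr: "bij (transl a)"
proof (rule o_bij)
  show "transl_inv a \<circ> transl a = id"
    using linear_bw_eqI[OF linear_compose'[OF linear_tri linear_tr] linear_ident']
    by (auto simp: fun_eq_iff tr_bw tri_bw linear_scaleD[OF linear_tri])
  show "transl a \<circ> transl_inv a = id"
    using linear_bw_eqI[OF linear_compose'[OF linear_tr linear_tri] linear_ident']
    by (auto simp: fun_eq_iff tr_bw tri_bw linear_scaleD[OF linear_tr])
qed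

lemma linear_scale': "Vector_Spaces.linear scale scale f \<Longrightarrow> Vector_Spaces.linear scale scale (\<lambda>v. scale c (f v))"
  for f :: "fock \<Rightarrow> fock"
  by (intro linear_scaleI) (auto simp: linear_scaleD scale_add mult.commute)

lemma wedging_tr:
  "wedging (shift_mode a x) (transl a v) = scale (if fst x = a then 1 else -1) (transl a (wedging x v))"
proof (rule linear_bw_eqI[OF linear_compose'[OF linear_wedging linear_tr]
        linear_scale'[OF linear_compose'[OF linear_tr linear_wedging]]])
  fix S assume S: "adm S"
  show "wedging (shift_mode a x) (transl a (bw S)) = scale (if fst x = a then 1 else -1) (transl a (wedging x (bw S)))"
    using S sign_key[OF S, of x a]
    by (auto simp: tr_bw wedging_bw linear_scaleD[OF linear_tr] linear_scaleD[OF linear_wedging] mult_ac)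
qed

lemma contraction_tr:
  "contraction (shift_mode a x) (transl a v) = scale (if fst x = a then 1 else -1) (transl a (contraction x v))"
proof (rule linear_bw_eqI[OF linear_compose'[OF linear_contraction linear_tr]
        linear_scale'[OF linear_compose'[OF linear_tr linear_contraction]]])
  fix S assume S: "adm S"
  show "contraction (shift_mode a x) (transl a (bw S)) = scale (if fst x = a then 1 else -1) (transl a (contraction x (bw S)))"
  proof (cases "x \<in> S")
    case False
    then show ?thesis using S
      by (simp add: tr_bw contraction_bw linear_scaleD[OF linear_tr] linear_scaleD[OF linear_contraction])
  next
    case True
    have im: "shift_mode a ` S - {shift_mode a x} = shift_mode a ` (S - {x})" by (simp add: image_set_diff)
    have k: "wsign (shift_mode a x) (shift_mode a ` S) * tsign a (S - {x}) = (if fst x = a then 1 else -1) * tsign a S * wsign x S"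
      using sign_key[of "S - {x}" x a] S True wsign_remove[OF S True, of x] 
        wsign_remove[OF adm_sh(1)[OF S], of "shift_mode a x" a "shift_mode a x"]
      by (simp add: insert_absorb im)
    have "tsign a S * wsign (shift_mode a x) (shift_mode a ` S) 
        = tsign a S * (wsign (shift_mode a x) (shift_mode a ` S) * tsign a (S - {x})) * tsign a (S - {x})" by simp
    also have "\<dots> = (if fst x = a then 1 else -1) * wsign x S * tsign a (S - {x})"
      unfolding k by simp
    finally show ?thesis using S True
      by (auto simp: tr_bw contraction_bw linear_scaleD[OF linear_tr] linear_scaleD[OF linear_contraction] im mult_ac)
  qed
qed

lemma tr_v0: "transl a v0 = psip a (-1) v0"
proof -
  have "tset a vac_modes = {}" by (auto simp: tset_def vac_modes_def)
  moreover have "{s \<in> vac_modes. mode_pos s < mode_pos (a, - 1)} = {}"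
    by (auto simp: vac_modes_def mode_pos_def)
  moreover have "(a, -1) \<notin> vac_modes" by (simp add: vac_modes_def)
  ultimately show ?thesis
    by (simp add: v0_bw tr_bw psip_def wedging_bw sh_vac tsign_def wsign_def del: Collect_empty_eq)
qed

lemma tr_psi:
  "psip a k (transl a v) = transl a (psip a (k + 1) v)"
  "psim a k (transl a v) = transl a (psim a (k - 1) v)"
  "a \<noteq> b \<Longrightarrow> psip a k (transl b v) = - transl b (psip a k v)"
  "a \<noteq> b \<Longrightarrow> psim a k (transl b v) = - transl b (psim a k v)"
  using wedging_tr[of a "(a, k + 1)" v] wedging_tr[of b "(a, k)" v]
    contraction_tr[of a "(a, - k)" v] contraction_tr[of b "(a, - k - 1)" v]
  by (auto simp: psip_def psim_def shift_mode_def linear_scaleD[OF linear_tr])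

lemma minus_eq_0: "(u::fock) = - v \<longleftrightarrow> u + v = 0"
  by (simp add: eq_neg_iff_add_eq_0)

lemma tr_tr:
  assumes "a \<noteq> b"
  shows "transl a (transl b v) = - transl b (transl a v)"
proof (induction v rule: fock_induct)
  case v0
  have "transl a (transl b v0) = - psip b (-1) (psip a (-1) v0)"
    using tr_psi(3)[of b a "-1" v0] assms by (simp add: tr_v0)
  moreover have "transl b (transl a v0) = - psip a (-1) (psip b (-1) v0)"
    using tr_psi(3)[of a b "-1" v0] assms by (simp add: tr_v0)
  ultimately show ?case using psip_psip[of a "-1" b "-1" v0] by simp
next
  case (psip c k v)
  have c: "c = a \<or> c = b" using assms by (cases a; cases b; cases c) auto
  have 1: "transl x (transl y (psip x k v)) = - psip x (k - 1) (transl x (transl y v))" 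
    "transl y (transl x (psip x k v)) = - psip x (k - 1) (transl y (transl x v))" if "x \<noteq> y" for x y
  proof -
    have "transl y (psip x k v) = - psip x k (transl y v)" using tr_psi(3)[OF that] by simp
    then show "transl x (transl y (psip x k v)) = - psip x (k - 1) (transl x (transl y v))"
      using tr_psi(1)[of x "k - 1"] by (simp add: linear_scaleD[OF linear_tr])
    have "transl x (psip x k v) = psip x (k - 1) (transl x v)" using tr_psi(1)[of x "k - 1"] by simp
    then show "transl y (transl x (psip x k v)) = - psip x (k - 1) (transl y (transl x v))"
      using tr_psi(3)[OF that, of "k - 1"] by simp
  qed
  from c show ?case
    using 1[OF assms] 1[OF assms[symmetric]] psip by (auto simp: linear_scaleD[OF linear_psip])
next
  case (psim c k v)
  have c: "c = a \<or> c = b" using assms by (cases a; cases b; cases c) auto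
  have 1: "transl x (transl y (psim x k v)) = - psim x (k + 1) (transl x (transl y v))" 
    "transl y (transl x (psim x k v)) = - psim x (k + 1) (transl y (transl x v))" if "x \<noteq> y" for x y
  proof -
    have "transl y (psim x k v) = - psim x k (transl y v)" using tr_psi(4)[OF that] by simp
    then show "transl x (transl y (psim x k v)) = - psim x (k + 1) (transl x (transl y v))"
      using tr_psi(2)[of x "k + 1"] by (simp add: linear_scaleD[OF linear_tr])
    have "transl x (psim x k v) = psim x (k + 1) (transl x v)" using tr_psi(2)[of x "k + 1"] by simp
    then show "transl y (transl x (psim x k v)) = - psim x (k + 1) (transl y (transl x v))"
      using tr_psi(4)[OF that, of "k + 1"] by simp
  qed
  from c show ?case
    using 1[OF assms] 1[OF assms[symmetric]] psim by (auto simp: linear_scaleD[OF linear_psim])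
qed (simp_all add: linear_scaleD[OF linear_tr])

lemma fermionic_translations_tr: "fermionic_translations transl"
  unfolding fermionic_translations_def psip_field_def psim_field_def
  by (intro conjI allI impI linear_tr bij_tr tr_v0 tr_tr tr_psi(3,4); (assumption | simp add: tr_psi(1,2)))

lemma fermionic_translations_psi:
  assumes "fermionic_translations Q"
  shows "Vector_Spaces.linear scale scale (Q a)" "bij (Q a)" "Q a v0 = psip a (-1) v0"
    "Q a (psip b k v) = (if a = b then psip b (k - 1) (Q a v) else - psip b k (Q a v))"
    "Q a (psim b k v) = (if a = b then psim b (k + 1) (Q a v) else - psim b k (Q a v))"
    "a \<noteq> b \<Longrightarrow> Q a (Q b v) = - Q b (Q a v)"
proof -
  note Q = assms[unfolded fermionic_translations_def]
  show "Vector_Spaces.linear scale scale (Q a)" "bij (Q a)" "Q a v0 = psip a (-1) v0"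
    "a \<noteq> b \<Longrightarrow> Q a (Q b v) = - Q b (Q a v)" using Q by blast+
  have 1: "psip_field a n (Q a v) = Q a (psip_field a (n - 1) v)"
    "psim_field a n (Q a v) = Q a (psim_field a (n + 1) v)" 
    "b \<noteq> a \<Longrightarrow> psip_field b n (Q a v) = - Q a (psip_field b n v)"
    "b \<noteq> a \<Longrightarrow> psim_field b n (Q a v) = - Q a (psim_field b n v)" for n using Q by blast+
  show "Q a (psip b k v) = (if a = b then psip b (k - 1) (Q a v) else - psip b k (Q a v))"
    using 1(1)[of "- k"] 1(3)[of "- k - 1"] by (auto simp: psip_field_def)
  show "Q a (psim b k v) = (if a = b then psim b (k + 1) (Q a v) else - psim b k (Q a v))"
    using 1(2)[of "- k - 2"] 1(4)[of "- k - 1"] by (auto simp: psim_field_def add.commute)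
qed

theorem fermionic_translations_ex1: "\<exists>!Q. fermionic_translations Q"
proof (intro ex1I[of _ transl] fermionic_translations_tr ext)
  fix Q a v assume "fermionic_translations Q"
  note Q = fermionic_translations_psi[OF this] and R = fermionic_translations_psi[OF fermionic_translations_tr]
  show "Q a v = transl a v"
    by (induction v rule: fock_induct)
      (auto simp add: Q R linear_scaleD[OF Q(1)] linear_scaleD[OF R(1)])
qed

lemma fermionic_translations_Q_op: "fermionic_translations Q_op"
  unfolding Q_op_def by (rule theI'[OF fermionic_translations_ex1])

subsection \<open>Elementary wedges\<close>

text \<open>\<open>M\<^sub>a v\<close>, for the mode sets \<open>K\<close> of \<open>M\<^sub>a\<^sup>+\<close> and \<open>L\<close> of \<open>M\<^sub>a\<^sup>-\<close>\<close>
definition elem_M :: "bit \<Rightarrow> int set \<Rightarrow> int set \<Rightarrow> fock \<Rightarrow> fock" where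
  "elem_M a K L v = foldr (psip a) (sorted_list_of_set K) (foldr (psim a) (sorted_list_of_set L) v)"

definition elementary_wedge :: "(bit \<Rightarrow> int set) \<Rightarrow> (bit \<Rightarrow> int set) \<Rightarrow> fock" where
  "elementary_wedge K L = elem_M 1 (K 1) (L 1) (elem_M 0 (K 0) (L 0) v0)"

definition signed_wedge :: "fock \<Rightarrow> mode set \<Rightarrow> bool" where
  "signed_wedge u S \<longleftrightarrow> adm S \<and> (u = bw S \<or> u = - bw S)"

lemma pm_scale: "signed_wedge (scale c u) S \<longleftrightarrow> signed_wedge u S" if "c = 1 \<or> c = -1"
  using that by (auto simp: signed_wedge_def minus_equation_iff[of u])

lemma wsign_cases: "wsign x S = 1 \<or> wsign x S = -1"
  unfolding wsign_def by (cases "even (card {s \<in> S. mode_pos s < mode_pos x})") simp_all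

lemma pm_psip: "signed_wedge u S \<Longrightarrow> (a, k) \<notin> S \<Longrightarrow> signed_wedge (psip a k u) (insert (a, k) S)"
  using wsign_cases[of "(a,k)" S]
  by (auto simp: signed_wedge_def psip_def wedging_bw linear_scaleD[OF linear_wedging])

lemma pm_psim: "signed_wedge u S \<Longrightarrow> (a, - k - 1) \<in> S \<Longrightarrow> signed_wedge (psim a k u) (S - {(a, - k - 1)})"
  using wsign_cases[of "(a, - k - 1)" S]
  by (auto simp: signed_wedge_def psim_def contraction_bw linear_scaleD[OF linear_contraction])

lemma pm_psips:
  assumes "signed_wedge u S" "distinct ks" "\<forall>k\<in>set ks. (a, k) \<notin> S"
  shows "signed_wedge (foldr (psip a) ks u) (S \<union> Pair a ` set ks)"
  using assms
proof (induction ks)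
  case (Cons k ks)
  then have "signed_wedge (psip a k (foldr (psip a) ks u)) (insert (a, k) (S \<union> Pair a ` set ks))"
    by (intro pm_psip) auto
  then show ?case by simp
qed simp

lemma pm_psims:
  assumes "signed_wedge u S" "distinct ks" "\<forall>k\<in>set ks. (a, - k - 1) \<in> S"
  shows "signed_wedge (foldr (psim a) ks u) (S - (\<lambda>k. (a, - k - 1)) ` set ks)"
  using assms
proof (induction ks)
  case (Cons k ks)
  then have "signed_wedge (psim a k (foldr (psim a) ks u)) ((S - (\<lambda>k. (a, - k - 1)) ` set ks) - {(a, - k - 1)})"
    by (intro pm_psim) auto
  also have "(S - (\<lambda>k. (a, - k - 1)) ` set ks) - {(a, - k - 1)} = S - (\<lambda>k. (a, - k - 1)) ` set (k # ks)"
    by auto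
  finally show ?case by simp
qed simp

definition elem_factors :: "(bit \<Rightarrow> int set) \<Rightarrow> (bit \<Rightarrow> int set) \<Rightarrow> mode set" where
  "elem_factors K L = {(a, k). if k < 0 then k \<in> K a else - k - 1 \<notin> L a}"

lemma pm_elementary_wedge:
  assumes "\<And>a. finite (K a)" "\<And>a. finite (L a)" "\<And>a. K a \<subseteq> {..-1}" "\<And>a. L a \<subseteq> {..-1}"
  shows "signed_wedge (elementary_wedge K L) (elem_factors K L)"
proof -
  have v: "signed_wedge v0 vac_modes" by (simp add: signed_wedge_def v0_bw)
  have neg: "k < 0" if "k \<in> K a \<or> k \<in> L a" for k a using assms(3)[of a] assms(4)[of a] that by auto
  have step: "signed_wedge (elem_M a (K a) (L a) u) ((S - (\<lambda>k. (a, - k - 1)) ` L a) \<union> Pair a ` K a)"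
    if "signed_wedge u S" "\<And>k. (a, k) \<in> S \<longleftrightarrow> 0 \<le> k" for a u S
    unfolding elem_M_def
    using pm_psips[OF pm_psims[OF that(1)], of "sorted_list_of_set (L a)" a "sorted_list_of_set (K a)" a]
      neg[of _ a] that(2) assms(1,2)[of a] by force
  let ?S0 = "(vac_modes - (\<lambda>k. (0, - k - 1)) ` L 0) \<union> Pair 0 ` K 0"
  let ?S1 = "(?S0 - (\<lambda>k. (1, - k - 1)) ` L 1) \<union> Pair 1 ` K 1"
  have "signed_wedge (elementary_wedge K L) ?S1"
    unfolding elementary_wedge_def
    by (intro step v) (auto simp: vac_modes_def)
  also have "?S1 = elem_factors K L"
  proof (rule set_eqI)
    fix x :: mode
    obtain a k where x: "x = (a, k)" by force
    have i: "k \<in> (\<lambda>k. - k - 1) ` A \<longleftrightarrow> - k - 1 \<in> A" for A :: "int set"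
      by (metis (no_types, lifting) image_iff diff_diff_eq2 diff_minus_eq_add minus_diff_eq add_diff_cancel_left' add.commute)
    show "x \<in> ?S1 \<longleftrightarrow> x \<in> elem_factors K L"
      using neg[of k a] neg[of "- k - 1" a] i[of "L a"]
      by (cases a) (auto simp: x elem_factors_def vac_modes_def image_iff)
  qed
  finally show ?thesis .
qed

lemma pairing_bw: "adm S \<Longrightarrow> adm S' \<Longrightarrow> pairing (bw S) (bw S') = (if S = S' then 1 else 0)"
  by (simp add: pairing_def bw_def lookup_basis Wedge_inject')

lemma keys_uminus_fock [simp]: "keys (- u) = keys u" for u :: fock
  by (auto simp: in_keys_iff)

lemma pairing_uminus: "pairing (- u) v = - pairing u v" "pairing u (- v) = - pairing u v"
  by (simp_all add: pairing_def sum_negf)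

theorem elementary_wedges_orthonormal:
  assumes "\<And>a. finite (K a)" "\<And>a. finite (L a)" "\<And>a. K a \<subseteq> {..-1}" "\<And>a. L a \<subseteq> {..-1}"
    and "\<And>a. finite (K' a)" "\<And>a. finite (L' a)" "\<And>a. K' a \<subseteq> {..-1}" "\<And>a. L' a \<subseteq> {..-1}"
  shows "pairing (elementary_wedge K L) (elementary_wedge K' L') = (if K = K' \<and> L = L' then 1 else 0)"
proof -
  have inj: "K = K' \<and> L = L'" if "elem_factors K L = elem_factors K' L'"
  proof -
    have e: "(a, k) \<in> elem_factors K L \<longleftrightarrow> (a, k) \<in> elem_factors K' L'" for a k using that by simp
    have "k \<in> K a \<longleftrightarrow> k \<in> K' a" for a k
      using e[of a k] assms(3)[of a] assms(7)[of a] by (cases "k < 0") (auto simp: elem_factors_def)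
    moreover have "k \<in> L a \<longleftrightarrow> k \<in> L' a" for a k
      using e[of a "- k - 1"] assms(4)[of a] assms(8)[of a] by (cases "k < 0") (auto simp: elem_factors_def)
    ultimately show ?thesis by (auto simp: fun_eq_iff set_eq_iff)
  qed
  have 1: "signed_wedge (elementary_wedge K L) (elem_factors K L)" "signed_wedge (elementary_wedge K' L') (elem_factors K' L')"
    using assms by (simp_all add: pm_elementary_wedge)
  show ?thesis
  proof (cases "K = K' \<and> L = L'")
    case True
    then show ?thesis using 1(1) by (auto simp: signed_wedge_def pairing_bw pairing_uminus)
  next
    case False
    then have "elem_factors K L \<noteq> elem_factors K' L'" using inj by blast
    then show ?thesis using 1 False by (auto simp: signed_wedge_def pairing_bw pairing_uminus)
  qed
qed

theorem basis_elementary_wedge: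
  obtains K L where "\<And>a. finite (K a)" "\<And>a. finite (L a)" "\<And>a. K a \<subseteq> {..-1}" "\<And>a. L a \<subseteq> {..-1}"
    "basis W = elementary_wedge K L \<or> basis W = - elementary_wedge K L"
proof -
  define K where "K = (\<lambda>a. {k. k < 0 \<and> (a, k) \<in> factors W})"
  define L where "L = (\<lambda>a. {k. k < 0 \<and> (a, - k - 1) \<notin> factors W})"
  have fin: "finite (sym_diff (factors W) vac_modes)" using adm_factors[of W] by (simp add: adm_def)
  have "K a \<subseteq> snd ` sym_diff (factors W) vac_modes" for a
    by (force simp: K_def vac_modes_def)
  then have K: "finite (K a)" for a using fin by (meson finite_imageI finite_subset)
  have "L a \<subseteq> (\<lambda>x. - snd x - 1) ` sym_diff (factors W) vac_modes" for a
  proof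
    fix k assume "k \<in> L a"
    then have "(a, - k - 1) \<in> sym_diff (factors W) vac_modes" by (auto simp: L_def vac_modes_def)
    then show "k \<in> (\<lambda>x. - snd x - 1) ` sym_diff (factors W) vac_modes" by (rule rev_image_eqI) simp
  qed
  then have L: "finite (L a)" for a using fin by (meson finite_imageI finite_subset)
  have KL: "K a \<subseteq> {..-1}" "L a \<subseteq> {..-1}" for a by (auto simp: K_def L_def)
  have "elem_factors K L = factors W" by (auto simp: elem_factors_def K_def L_def split: if_splits)
  then show ?thesis using that[of K L, OF K L KL] pm_elementary_wedge[of K L, OF K L KL]
    by (auto simp: signed_wedge_def bw_factors)
qed

subsection \<open>Finiteness of the sums, and polynomiality of \<open>tau\<close>\<close>

lemma finite_bounded_monoms:
  assumes "finite A"
  shows "finite {m :: monom. keys m \<subseteq> A \<and> (\<forall>i. lookup m i \<le> n)}" (is "finite ?M")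
proof -
  have "lookup ` ?M \<subseteq> {f. \<forall>i. (i \<in> A \<longrightarrow> f i \<in> {0..n}) \<and> (i \<notin> A \<longrightarrow> f i = 0)}"
    by (auto simp: in_keys_iff)
  moreover have "finite \<dots>" using assms by (intro finite_set_of_finite_funs) auto
  ultimately have "finite (lookup ` ?M)" by (rule finite_subset)
  then show ?thesis by (rule finite_imageD) (meson inj_onI poly_mapping.lookup_inject)
qed

lemma finite_splits: "finite {(m1, m2). m1 + m2 = (m :: monom)}"
proof -
  let ?n = "\<Sum>i\<in>keys m. lookup m i"
  let ?M = "{m' :: monom. keys m' \<subseteq> keys m \<and> (\<forall>i. lookup m' i \<le> ?n)}"
  have le: "lookup m i \<le> ?n" for i
    by (cases "i \<in> keys m") (auto intro: member_le_sum simp: in_keys_iff)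
  have "m1 \<in> ?M \<and> m2 \<in> ?M" if "m1 + m2 = m" for m1 m2
  proof -
    have l: "lookup m i = lookup m1 i + lookup m2 i" for i using that by (auto simp: lookup_add)
    have "lookup m1 i \<le> ?n \<and> lookup m2 i \<le> ?n" for i using le[of i] l[of i] by linarith
    with l show ?thesis by (auto simp: in_keys_iff)
  qed
  then have "{(m1, m2). m1 + m2 = m} \<subseteq> ?M \<times> ?M" by blast
  moreover have "finite (?M \<times> ?M)" by (intro finite_cartesian_product finite_bounded_monoms finite_keys)
  ultimately show ?thesis by (rule finite_subset)
qed

lemma lookup_C_alpha: "lookup (C_alpha \<alpha> (- 1 - p - q)) m
    = (if m = Poly_Mapping.single (\<alpha> + p + q) 1 then (-1) powi \<alpha> else 0)"
  by (auto simp: C_alpha_def C_series_def cvar_def lookup_single when_def algebra_simps)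

lemma cmult_nonzeroD:
  assumes "lookup (cmult (C_alpha \<alpha> (- 1 - p - q)) u m) W \<noteq> 0"
  obtains m' where "m = Poly_Mapping.single (\<alpha> + p + q) 1 + m'" "lookup (u m') W \<noteq> 0"
proof -
  obtain m1 m2 where m: "m1 + m2 = m" 
    "lookup (scale (lookup (C_alpha \<alpha> (- 1 - p - q)) m1) (u m2)) W \<noteq> 0"
    using assms unfolding cmult_def lookup_sum
    by (auto elim!: sum.not_neutral_contains_not_neutral)
  then show ?thesis using that[of m2] by (auto simp: lookup_C_alpha split: if_splits)
qed

lemma wedging_contraction_nonzeroD:
  assumes "lookup (wedging x (contraction y u)) W \<noteq> 0" "x \<noteq> y"
  obtains W' where "W' \<in> keys u" "y \<in> factors W'" "x \<notin> factors W'"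
    "factors W = insert x (factors W' - {y})"
proof -
  have "wedging x (contraction y u) = (\<Sum>W'\<in>keys u. scale (lookup u W') (wedging x (contraction y (basis W'))))"
    by (subst basis_expansion[of u])
      (simp add: linear_scaleD[OF linear_wedging] linear_scaleD[OF linear_contraction])
  with assms(1) obtain W' where W': "W' \<in> keys u" "lookup (wedging x (contraction y (basis W'))) W \<noteq> 0"
    by (auto simp: lookup_sum elim!: sum.not_neutral_contains_not_neutral)
  then have "y \<in> factors W'" "x \<notin> factors W'" "W = Wedge (insert x (factors W' - {y}))"
    using assms(2)
    by (auto simp: bw_factors wedging_bw contraction_bw linear_scaleD[OF linear_wedging] split: if_splits)
      (auto simp: bw_def lookup_basis split: if_splits)
  with W' show ?thesis using that[of W'] by simp
qed

lemma fields_modes: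
  "psip_field 1 p (psim_field 0 q u) = wedging (1, - p - 1) (contraction (0, q) u)"
  by (simp add: psip_field_def psim_field_def psip_def psim_def)

theorem res_op_finite:
  "finite {(p, q). cmult (C_alpha \<alpha> (- 1 - p - q)) (\<lambda>m'. psip_field 1 p (psim_field 0 q (v m'))) m \<noteq> 0}"
    (is "finite ?A")
proof -
  let ?B = "\<lambda>m1 W. {(p, q). m1 = Poly_Mapping.single (\<alpha> + p + q) (1::nat) \<and> (0, q) \<in> factors W \<and> (1, - p - 1) \<notin> factors W}"
  have "?A \<subseteq> (\<Union>(m1, m2)\<in>{(m1, m2). m1 + m2 = m}. \<Union>W\<in>keys (v m2). ?B m1 W)"
  proof (clarify)
    fix p q
    assume "cmult (C_alpha \<alpha> (- 1 - p - q)) (\<lambda>m'. psip_field 1 p (psim_field 0 q (v m'))) m \<noteq> 0"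
    then obtain W where "lookup (cmult (C_alpha \<alpha> (- 1 - p - q)) (\<lambda>m'. psip_field 1 p (psim_field 0 q (v m'))) m) W \<noteq> 0"
      by (metis lookup_zero poly_mapping_eqI)
    then obtain m' where m': "m = Poly_Mapping.single (\<alpha> + p + q) 1 + m'"
      "lookup (wedging (1, - p - 1) (contraction (0, q) (v m'))) W \<noteq> 0"
      using cmult_nonzeroD[of \<alpha> p q _ m W] unfolding fields_modes by metis
    from wedging_contraction_nonzeroD[OF m'(2)] obtain W' where
      "W' \<in> keys (v m')" "(0, q) \<in> factors W'" "(1, - p - 1) \<notin> factors W'" by auto
    then show "(p, q) \<in> (\<Union>(m1, m2)\<in>{(m1, m2). m1 + m2 = m}. \<Union>W\<in>keys (v m2). ?B m1 W)"
      using m'(1) by blast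
  qed
  moreover have "finite (?B m1 W)" for m1 W
  proof (cases "\<exists>s. m1 = Poly_Mapping.single s (1::nat)")
    case True
    then obtain s where s: "m1 = Poly_Mapping.single s (1::nat)" by blast
    have fin: "finite (snd ` sym_diff (factors W) vac_modes)" using adm_factors[of W] by (simp add: adm_def)
    define N where "N = Max (insert 0 (abs ` snd ` sym_diff (factors W) vac_modes))"
    have N: "\<bar>k\<bar> \<le> N" if "(a, k) \<in> sym_diff (factors W) vac_modes" for a k
      unfolding N_def by (intro Max_ge) (use fin that in force)+
    have N0: "0 \<le> N" unfolding N_def by (intro Max_ge) (use fin in auto)
    have "?B m1 W \<subseteq> (\<lambda>q. (s - \<alpha> - q, q)) ` {- N..s - \<alpha> + N + 1}"
    proof clarify
      fix p q assume a: "m1 = Poly_Mapping.single (\<alpha> + p + q) (1::nat)" "(0, q) \<in> factors W" "(1, - p - 1) \<notin> factors W"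
      have "s = \<alpha> + p + q" using a(1) unfolding s by (metis lookup_single_eq lookup_single_not_eq zero_neq_one)
      moreover have "- N \<le> q" using a(2) N[of 0 q] N0 by (cases "q < 0") (auto simp: vac_modes_def)
      moreover have "- N - 1 \<le> p" using a(3) N[of 1 "- p - 1"] N0 by (cases "p < 0") (auto simp: vac_modes_def)
      ultimately show "(p, q) \<in> (\<lambda>q. (s - \<alpha> - q, q)) ` {- N..s - \<alpha> + N + 1}" by auto
    qed
    then show ?thesis by (rule finite_subset) auto
  next
    case False
    then have "?B m1 W = {}" by auto
    then show ?thesis by (simp only: finite.emptyI)
  qed
  ultimately show ?thesis
    by (elim finite_subset) (auto intro!: finite_UN_I finite_splits)
qed

lemma lookup_Sum_any_nonzeroD:
  assumes "lookup (Sum_any f) W \<noteq> 0"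
  obtains x where "lookup (f x) W \<noteq> 0"
  using assms unfolding Sum_any.expand_set
  by (auto simp: lookup_sum elim!: sum.not_neutral_contains_not_neutral split: if_splits)

lemma res_op_nonzeroD:
  assumes "lookup (res_op \<alpha> v m) W \<noteq> 0"
  obtains i j m' W' where "m = Poly_Mapping.single (\<alpha> - 1 - j + i) 1 + m'" "lookup (v m') W' \<noteq> 0"
    "(0, i) \<in> factors W'" "(1, j) \<notin> factors W'" "factors W = insert (1, j) (factors W' - {(0, i)})"
proof -
  from assms obtain p q where 
    "lookup (cmult (C_alpha \<alpha> (- 1 - p - q)) (\<lambda>m'. psip_field 1 p (psim_field 0 q (v m'))) m) W \<noteq> 0"
    unfolding res_op_def by (elim lookup_Sum_any_nonzeroD) (auto split: prod.splits)
  then obtain m' where m': "m = Poly_Mapping.single (\<alpha> + p + q) 1 + m'"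
    "lookup (wedging (1, - p - 1) (contraction (0, q) (v m'))) W \<noteq> 0"
    using cmult_nonzeroD[of \<alpha> p q _ m W] unfolding fields_modes by metis
  from wedging_contraction_nonzeroD[OF m'(2)] obtain W' where
    "W' \<in> keys (v m')" "(0, q) \<in> factors W'" "(1, - p - 1) \<notin> factors W'"
    "factors W = insert (1, - p - 1) (factors W' - {(0, q)})" by auto
  then show ?thesis using that[of "- p - 1" q m' W'] m'(1) by (auto simp: in_keys_iff add_ac)
qed

definition mdeg :: "monom \<Rightarrow> nat" where "mdeg m = (\<Sum>i\<in>keys m. lookup m i)"

lemma mdeg_single_add: "mdeg (Poly_Mapping.single i 1 + m) = Suc (mdeg m)"
  unfolding mdeg_def
  using setsum_keys_plus_distrib[of "\<lambda>_ x. x" "Poly_Mapping.single i 1" m] by simp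

lemma res_op_power_deg:
  "lookup ((res_op \<alpha> ^^ n) v m) W \<noteq> 0 \<Longrightarrow> n \<le> mdeg m"
proof (induction n arbitrary: m W)
  case (Suc n)
  then have "lookup (res_op \<alpha> ((res_op \<alpha> ^^ n) v) m) W \<noteq> 0" by simp
  then obtain i m' W' where "m = Poly_Mapping.single i 1 + m'" "lookup ((res_op \<alpha> ^^ n) v m') W' \<noteq> 0"
    by (rule res_op_nonzeroD)
  with Suc.IH show ?case using mdeg_single_add by fastforce
qed simp

theorem g_op_finite: "finite {n. scale (1 / fact n) ((res_op \<alpha> ^^ n) v m) \<noteq> 0}"
proof (rule finite_subset)
  show "{n. scale (1 / fact n) ((res_op \<alpha> ^^ n) v m) \<noteq> 0} \<subseteq> {..mdeg m}"
  proof (rule subsetI, unfold mem_Collect_eq)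
    fix n assume "scale (1 / fact n) ((res_op \<alpha> ^^ n) v m) \<noteq> 0"
    then obtain W where "lookup (scale (1 / fact n) ((res_op \<alpha> ^^ n) v m)) W \<noteq> 0"
      by (metis lookup_zero poly_mapping_eqI)
    then show "n \<in> {..mdeg m}" using res_op_power_deg[of n \<alpha> v m W] by simp
  qed
qed simp

definition wD :: "wedge \<Rightarrow> int set" where "wD W = {j. j < 0 \<and> (1, j) \<in> factors W}"
definition wE :: "wedge \<Rightarrow> int set" where "wE W = {i. 0 \<le> i \<and> (0, i) \<notin> factors W}"

lemma finite_wD: "finite (wD W)" and finite_wE: "finite (wE W)"
proof -
  have fin: "finite (snd ` sym_diff (factors W) vac_modes)" using adm_factors[of W] by (simp add: adm_def)
  have "wD W \<subseteq> snd ` sym_diff (factors W) vac_modes" "wE W \<subseteq> snd ` sym_diff (factors W) vac_modes"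
    by (force simp: wD_def wE_def vac_modes_def)+
  with fin show "finite (wD W)" "finite (wE W)" by (meson finite_subset)+
qed

lemma res_op_power_v0:
  "lookup ((res_op \<alpha> ^^ n) (const_series v0) m) W \<noteq> 0 \<Longrightarrow>
     (\<forall>i. lookup m i \<le> card (wD W)) \<and> keys m \<subseteq> (\<lambda>(j, i). \<alpha> - 1 - j + i) ` (wD W \<times> wE W) \<and>
     (\<forall>k. 0 \<le> k \<longrightarrow> (1, k) \<in> factors W) \<and> (\<forall>k. k < 0 \<longrightarrow> (0, k) \<notin> factors W)"
proof (induction n arbitrary: m W)
  case 0
  then have "m = 0" "factors W = vac_modes"
    by (auto simp: const_series_def v0_def lookup_basis split: if_splits)
  then show ?case by (auto simp: vac_modes_def)
next
  case (Suc n)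
  then have "lookup (res_op \<alpha> ((res_op \<alpha> ^^ n) (const_series v0)) m) W \<noteq> 0" by simp
  then obtain i j m' W' where *: "m = Poly_Mapping.single (\<alpha> - 1 - j + i) 1 + m'" 
    "lookup ((res_op \<alpha> ^^ n) (const_series v0) m') W' \<noteq> 0"
    "(0, i) \<in> factors W'" "(1, j) \<notin> factors W'" "factors W = insert (1, j) (factors W' - {(0, i)})"
    by (rule res_op_nonzeroD)
  note IH = Suc.IH[OF *(2)]
  have ij: "0 \<le> i" "j < 0" using IH *(3,4) by (meson not_le)+
  have D: "wD W = insert j (wD W')" "j \<notin> wD W'" using *(4,5) ij by (auto simp: wD_def)
  have E: "wE W = insert i (wE W')" using *(4,5) ij by (auto simp: wE_def)
  have card: "card (wD W) = Suc (card (wD W'))" using D finite_wD by simp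
  have "lookup m x \<le> card (wD W)" for x
  proof -
    have "lookup m x \<le> Suc (lookup m' x)" unfolding *(1) by (simp add: lookup_add lookup_single when_def)
    also have "lookup m' x \<le> card (wD W')" using IH by blast
    finally show ?thesis by (simp add: card)
  qed
  moreover have "keys m \<subseteq> (\<lambda>(j, i). \<alpha> - 1 - j + i) ` (wD W \<times> wE W)"
  proof -
    have "keys m \<subseteq> insert (\<alpha> - 1 - j + i) (keys m')" unfolding *(1) using keys_add[of "Poly_Mapping.single (\<alpha> - 1 - j + i) 1" m'] by auto
    also have "keys m' \<subseteq> (\<lambda>(j, i). \<alpha> - 1 - j + i) ` (wD W' \<times> wE W')" using IH by blast
    finally show ?thesis unfolding D E by auto
  qed
  ultimately show ?case using IH *(5) ij by auto
qed

theorem tau_finite: "finite {m. pairing (iterate_int T_op k v0) (g_op \<alpha> (const_series v0) m) \<noteq> 0}"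
proof (rule finite_subset)
  let ?u = "iterate_int T_op k v0"
  let ?M = "\<lambda>W. {m :: monom. keys m \<subseteq> (\<lambda>(j, i). \<alpha> - 1 - j + i) ` (wD W \<times> wE W) \<and> (\<forall>i. lookup m i \<le> card (wD W))}"
  show "{m. pairing ?u (g_op \<alpha> (const_series v0) m) \<noteq> 0} \<subseteq> (\<Union>W\<in>keys ?u. ?M W)"
  proof clarify
    fix m assume "pairing ?u (g_op \<alpha> (const_series v0) m) \<noteq> 0"
    then obtain W where W: "W \<in> keys ?u" "lookup (g_op \<alpha> (const_series v0) m) W \<noteq> 0"
      unfolding pairing_def by (auto elim!: sum.not_neutral_contains_not_neutral)
    from W(2) obtain n where "lookup ((res_op \<alpha> ^^ n) (const_series v0) m) W \<noteq> 0"
      unfolding g_op_def by (elim lookup_Sum_any_nonzeroD) auto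
    from res_op_power_v0[OF this] W(1) show "m \<in> (\<Union>W\<in>keys ?u. ?M W)" by blast
  qed
  show "finite (\<Union>W\<in>keys ?u. ?M W)"
    by (intro finite_UN_I finite_keys finite_bounded_monoms finite_imageI finite_cartesian_product finite_wD finite_wE)
qed

lemma lookup_tau: "lookup (tau \<alpha> k) m = pairing (iterate_int T_op k v0) (g_op \<alpha> (const_series v0) m)"
  unfolding tau_def by (rule fun_cong[OF lookup_Abs_poly_mapping]) (rule tau_finite)

end

theory Submission
  imports Defs
begin

text \<open>Fix \<open>\<alpha>\<close> and let
  \<open>D\<^sub>k = \<tau>\<^sub>k\<^sup>(\<^sup>\<alpha>\<^sup>-\<^sup>1\<^sup>) \<tau>\<^sub>k\<^sup>(\<^sup>\<alpha>\<^sup>+\<^sup>1\<^sup>) - \<tau>\<^sub>k\<^sub>+\<^sub>1\<^sup>(\<^sup>\<alpha>\<^sup>-\<^sup>1\<^sup>) \<tau>\<^sub>k\<^sub>-\<^sub>1\<^sup>(\<^sup>\<alpha>\<^sup>+\<^sup>1\<^sup>) - (\<tau>\<^sub>k\<^sup>(\<^sup>\<alpha>\<^sup>))\<^sup>2\<close>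
  be the defect of the \<open>2Q\<close>-system. Clearing denominators turns the equation between the ratios at
  \<open>k\<close> into \<open>D\<^sub>k (\<tau>\<^sub>k\<^sub>+\<^sub>1\<^sup>(\<^sup>\<alpha>\<^sup>))\<^sup>2 = D\<^sub>k\<^sub>+\<^sub>1 (\<tau>\<^sub>k\<^sup>(\<^sup>\<alpha>\<^sup>))\<^sup>2\<close>
  (\<open>ratio_equation_iff_defects\<close>). It therefore holds when all defects vanish. Conversely
  \<open>D\<^sub>0 = 0\<close>, because \<open>\<tau>\<^sub>0 = 1\<close> and \<open>\<tau>\<^sub>-\<^sub>1 = 0\<close>, and the equation carries the vanishing of
  \<open>D\<^sub>k\<close> to \<open>D\<^sub>k\<^sub>+\<^sub>1\<close>, because \<open>\<tau>\<^sub>k \<noteq> 0\<close>. The value \<open>\<tau>\<^sub>-\<^sub>1 = 0\<close> also accounts for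
  the convention \<open>1/h\<^sub>-\<^sub>1 = 0\<close>.

  What remains are the facts about \<open>\<tau>\<close>: \<open>tau_0\<close>, \<open>tau_neg\<close> and \<open>tau_nonzero\<close>. The vector
  \<open>T\<^sup>k v\<^sub>0\<close> is up to sign one wedge, so that \<open>\<tau>\<^sub>k\<close> is up to sign a coordinate of
  \<open>g\<^sub>C v\<^sub>0\<close>. The operator in the exponent of \<open>g\<^sub>C\<close> exchanges a factor \<open>e\<^sub>0z\<^sup>i\<close> for a factor
  \<open>e\<^sub>1z\<^sup>j\<close>; starting from \<open>v\<^sub>0\<close> it cannot produce an \<open>e\<^sub>0z\<^sup>i\<close> with \<open>i < 0\<close>, hence
  \<open>\<tau>\<^sub>k = 0\<close> for \<open>k < 0\<close>. For \<open>k \<ge> 0\<close> the polynomial \<open>\<tau>\<^sub>k\<^sup>(\<^sup>\<alpha>\<^sup>)\<close> is up to sign the Hankel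
  determinant of the \<open>c\<^sub>\<alpha>\<^sub>+\<^sub>i\<^sub>+\<^sub>j\<close>, \<open>0 \<le> i, j < k\<close>. It is enough to find one monomial that does
  not cancel, and that is the product \<open>c\<^sub>\<alpha>\<^sub>+\<^sub>k\<^sub>-\<^sub>1\<^sup>k\<close> along the antidiagonal. In the Fock space it
  arises only by exchanging \<open>e\<^sub>0z\<^sup>q\<close> for \<open>e\<^sub>1z\<^sup>q\<^sup>-\<^sup>k\<close>, for each \<open>0 \<le> q < k\<close> once and in any
  order. All \<open>k!\<close> orders turn out to contribute the same sign, so they add up
  (\<open>lookup_res_op_power\<close>).\<close>

section \<open>The translated vacuum\<close>

lemma Q_op_eq_transl: "Q_op = transl"
  using fermionic_translations_ex1 fermionic_translations_Q_op fermionic_translations_tr by blast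

lemma inv_transl: "inv (transl a) = transl_inv a"
proof (rule inv_unique_comp)
  show "transl a \<circ> transl_inv a = id"
    using linear_bw_eqI[OF linear_compose'[OF linear_tr linear_tri] linear_ident']
    by (auto simp: fun_eq_iff tr_bw tri_bw linear_scaleD[OF linear_tr])
  show "transl_inv a \<circ> transl a = id"
    using linear_bw_eqI[OF linear_compose'[OF linear_tri linear_tr] linear_ident']
    by (auto simp: fun_eq_iff tr_bw tri_bw linear_scaleD[OF linear_tri])
qed

lemma T_op_eq: "T_op = transl 1 \<circ> transl_inv 0"
  by (simp add: T_op_def Q_op_eq_transl inv_transl)

lemma inv_T_op_eq: "inv T_op = transl 0 \<circ> transl_inv 1"
  unfolding T_op_eq inv_transl[symmetric]
  by (simp add: o_inv_distrib bij_tr bij_imp_bij_inv inv_inv_eq)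

lemma tsign_cases: "tsign a S = 1 \<or> tsign a S = - 1"
  unfolding tsign_def by (cases "even (card (tset a S))") simp_all

lemma signed_wedge_transl:
  "signed_wedge u S \<Longrightarrow> signed_wedge (transl a u) (shift_mode a ` S)"
  using tsign_cases[of a S] by (auto simp: signed_wedge_def tr_bw linear_scaleD[OF linear_tr])

lemma signed_wedge_transl_inv:
  "signed_wedge u S \<Longrightarrow> signed_wedge (transl_inv a u) (unshift_mode a ` S)"
  using tsign_cases[of a "unshift_mode a ` S"]
  by (auto simp: signed_wedge_def tri_bw linear_scaleD[OF linear_tri])

text \<open>The factors of \<open>T\<^sup>k v\<^sub>0\<close>\<close>
definition charged_modes :: "int \<Rightarrow> mode set" where
  "charged_modes k = {x. (if fst x = 0 then k else - k) \<le> snd x}"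

lemma charged_modes_0: "charged_modes 0 = vac_modes"
  by (auto simp: charged_modes_def vac_modes_def)

lemma shift_mode_image: "shift_mode a ` S = {x. unshift_mode a x \<in> S}"
  by (metis (mono_tags, lifting) Collect_cong image_iff mem_Collect_eq set_eqI sh_shi)

lemma unshift_mode_image: "unshift_mode a ` S = {x. shift_mode a x \<in> S}"
  by (metis (mono_tags, lifting) Collect_cong image_iff mem_Collect_eq set_eqI sh_shi)

lemma shift_charged_modes:
  "shift_mode 1 ` unshift_mode 0 ` charged_modes k = charged_modes (k + 1)"
  "shift_mode 0 ` unshift_mode 1 ` charged_modes k = charged_modes (k - 1)"
  unfolding shift_mode_image unshift_mode_image charged_modes_def
  by (auto simp: shift_mode_def unshift_mode_def)

lemma signed_wedge_T_op:
  assumes "signed_wedge u (charged_modes k)"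
  shows "signed_wedge (T_op u) (charged_modes (k + 1))"
    and "signed_wedge (inv T_op u) (charged_modes (k - 1))"
  using signed_wedge_transl[OF signed_wedge_transl_inv[OF assms, of 0], of 1]
    signed_wedge_transl[OF signed_wedge_transl_inv[OF assms, of 1], of 0]
  unfolding inv_T_op_eq unfolding T_op_eq by (simp_all add: shift_charged_modes)

lemma signed_wedge_T_op_power:
  "signed_wedge ((T_op ^^ n) v0) (charged_modes (int n))"
  "signed_wedge ((inv T_op ^^ n) v0) (charged_modes (- int n))"
proof (induction n)
  case 0
  show "signed_wedge ((T_op ^^ 0) v0) (charged_modes (int 0))"
    "signed_wedge ((inv T_op ^^ 0) v0) (charged_modes (- int 0))"
    by (simp_all add: signed_wedge_def charged_modes_0 v0_bw)
next
  case (Suc n)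
  have "- int n - 1 = - (int n + 1)" by simp
  then show "signed_wedge ((T_op ^^ Suc n) v0) (charged_modes (int (Suc n)))"
    "signed_wedge ((inv T_op ^^ Suc n) v0) (charged_modes (- int (Suc n)))"
    using signed_wedge_T_op(1)[OF Suc(1)] signed_wedge_T_op(2)[OF Suc(2)]
    by (simp_all add: add.commute[of 1])
qed

text \<open>\<open>T\<close> permutes the wedges up to sign: \<open>Q\<^sub>0\<^sup>-\<^sup>1\<close> raises every exponent in the component
  \<open>e\<^sub>0\<close> by one and \<open>Q\<^sub>1\<close> lowers every exponent in the component \<open>e\<^sub>1\<close> by one.\<close>
lemma signed_wedge_iterate_T_op:
  "signed_wedge (iterate_int T_op k v0) (charged_modes k)"
  using signed_wedge_T_op_power[of "nat k"] signed_wedge_T_op_power[of "nat (- k)"]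
  by (auto simp: iterate_int_def)

lemma adm_charged_modes [simp]: "adm (charged_modes k)"
  using signed_wedge_iterate_T_op by (simp add: signed_wedge_def)

lemma pairing_bw_left: "pairing (bw S) v = lookup v (Wedge S)"
  by (simp add: pairing_def bw_def lookup_basis)

lemma lookup_tau_charged:
  "lookup (tau \<alpha> k) m = lookup (g_op \<alpha> (const_series v0) m) (Wedge (charged_modes k)) \<or>
   lookup (tau \<alpha> k) m = - lookup (g_op \<alpha> (const_series v0) m) (Wedge (charged_modes k))"
  using signed_wedge_iterate_T_op[of k]
  by (auto simp: lookup_tau signed_wedge_def pairing_uminus pairing_bw_left)

section \<open>Coefficients of the exponential\<close>

lemma lookup_linear:
  assumes "Vector_Spaces.linear scale scale f"
  shows "lookup (f u) W = (\<Sum>S\<in>keys u. lookup u S * lookup (f (basis S)) W)"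
  by (subst basis_expansion[of u]) (simp add: linear_scaleD[OF assms] lookup_sum)

lemma eq_Wedge_insert_iff:
  assumes "x \<notin> factors S"
  shows "W = Wedge (insert x (factors S)) \<longleftrightarrow> x \<in> factors W \<and> S = Wedge (factors W - {x})"
proof
  assume W: "W = Wedge (insert x (factors S))"
  have "factors W = insert x (factors S)" unfolding W by simp
  then have "x \<in> factors W" "factors W - {x} = factors S" using assms by simp_all
  then show "x \<in> factors W \<and> S = Wedge (factors W - {x})" by simp
next
  assume W: "x \<in> factors W \<and> S = Wedge (factors W - {x})"
  then have "factors S = factors W - {x}" by simp
  with W have "insert x (factors S) = factors W" by blast
  then show "W = Wedge (insert x (factors S))" by simp
qed

lemma lookup_wedging:
  "lookup (wedging x u) W = (if x \<in> factors W
     then wsign x (factors W - {x}) * lookup u (Wedge (factors W - {x})) else 0)"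
proof -
  have b: "lookup (wedging x (basis S)) W = (if x \<in> factors W \<and> S = Wedge (factors W - {x})
      then wsign x (factors W - {x}) else 0)" for S
  proof (cases "x \<in> factors S")
    case True
    then have "S \<noteq> Wedge (factors W - {x})" by (metis Diff_iff adm_Diff adm_factors factors_Wedge insertI1)
    with True show ?thesis by (simp add: bw_factors wedging_bw)
  next
    case False
    have "lookup (wedging x (basis S)) W
        = (if W = Wedge (insert x (factors S)) then wsign x (factors S) else 0)"
      using False by (simp add: bw_factors wedging_bw) (simp add: bw_def lookup_basis)
    also have "\<dots> = (if x \<in> factors W \<and> S = Wedge (factors W - {x})
        then wsign x (factors W - {x}) else 0)"
      unfolding eq_Wedge_insert_iff[OF False] by (rule if_cong) simp_all
    finally show ?thesis .
  qed
  show ?thesis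
    unfolding lookup_linear[OF linear_wedging, of x u W] b
    by (auto simp: if_distrib[of "times _"] in_keys_iff cong: if_cong)
qed

lemma lookup_contraction:
  "lookup (contraction x u) W = (if x \<in> factors W then 0
     else wsign x (factors W) * lookup u (Wedge (insert x (factors W))))"
proof -
  have c: "lookup (contraction x (basis S)) W
      = (if x \<in> factors S \<and> W = Wedge (factors S - {x}) then wsign x (factors S - {x}) else 0)" for S
  proof (cases "x \<in> factors S")
    case True
    have "contraction x (basis S) = scale (wsign x (factors S - {x})) (bw (factors S - {x}))"
      unfolding bw_factors[of S] using True by (simp add: contraction_bw wsign_remove)
    with True show ?thesis by (simp add: bw_def lookup_basis)
  next
    case False
    then show ?thesis by (simp add: bw_factors[of S] contraction_bw)
  qed
  have b: "lookup (contraction x (basis S)) W = (if x \<notin> factors W \<and> S = Wedge (insert x (factors W))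
      then wsign x (factors W) else 0)" for S
  proof (cases "x \<in> factors W")
    case True
    have "W \<noteq> Wedge (factors S - {x})"
    proof
      assume "W = Wedge (factors S - {x})"
      then have "factors W = factors S - {x}" by simp
      with True show False by simp
    qed
    with True c show ?thesis by simp
  next
    case False
    have "lookup (contraction x (basis S)) W
        = (if x \<in> factors S \<and> W = Wedge (factors S - {x}) then wsign x (factors S - {x}) else 0)"
      by (rule c)
    also have "\<dots> = (if S = Wedge (insert x (factors W)) then wsign x (factors W) else 0)"
      unfolding eq_Wedge_insert_iff[OF False] by (rule if_cong) simp_all
    finally show ?thesis using False by simp
  qed
  show ?thesis
    unfolding lookup_linear[OF linear_contraction, of x u W] b
    by (auto simp: if_distrib[of "times _"] in_keys_iff cong: if_cong)
qed

lemma lookup_wedging_contraction: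
  assumes "x \<noteq> y"
  shows "lookup (wedging x (contraction y u)) W = (if x \<in> factors W \<and> y \<notin> factors W
     then wsign x (factors W - {x}) * wsign y (factors W - {x})
        * lookup u (Wedge (insert y (factors W - {x}))) else 0)"
  using assms by (auto simp: lookup_wedging lookup_contraction)

text \<open>A power of \<open>c\<^sub>s\<close> splits off \<open>c\<^sub>\<alpha>\<^sub>+\<^sub>p\<^sub>+\<^sub>q\<close> only if the two variables agree, and then in one
  way.\<close>
lemma cmult_C_alpha_single:
  "cmult (C_alpha \<alpha> (- 1 - p - q)) u (Poly_Mapping.single s (Suc n)) =
     (if \<alpha> + p + q = s then scale ((-1) powi \<alpha>) (u (Poly_Mapping.single s n)) else 0)"
proof -
  let ?c = "Poly_Mapping.single :: int \<Rightarrow> nat \<Rightarrow> monom"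
  let ?A = "{(m1, m2). m1 + m2 = ?c s (Suc n)}"
  let ?f = "\<lambda>(m1, m2). scale (lookup (C_alpha \<alpha> (- 1 - p - q)) m1) (u m2)"
  \<comment> \<open>Comparing the exponents of \<open>c\<^sub>\<alpha>\<^sub>+\<^sub>p\<^sub>+\<^sub>q\<close> forces \<open>\<alpha> + p + q = s\<close>.\<close>
  have split: "(\<alpha> + p + q = s) \<and> m2 = ?c s n" if "?c (\<alpha> + p + q) 1 + m2 = ?c s (Suc n)" for m2
  proof -
    have l: "lookup (?c (\<alpha> + p + q) 1) i + lookup m2 i = lookup (?c s (Suc n)) i" for i
      by (simp flip: that add: lookup_add)
    from l[of "\<alpha> + p + q"] have s: "\<alpha> + p + q = s"
      by (auto simp: lookup_single when_def split: if_splits)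
    moreover have "m2 = ?c s n"
    proof (rule poly_mapping_eqI)
      show "lookup m2 i = lookup (?c s n) i" for i
        using l[of i] unfolding s by (auto simp: lookup_single when_def split: if_splits)
    qed
    ultimately show ?thesis by simp
  qed
  have add: "?c s 1 + ?c s n = ?c s (Suc n)" by (simp flip: single_add)
  have nz: "x = (?c (\<alpha> + p + q) 1, ?c s n) \<and> \<alpha> + p + q = s" if "x \<in> ?A" "?f x \<noteq> 0" for x
    using that split by (auto simp: lookup_C_alpha split: if_splits)
  show ?thesis
  proof (cases "\<alpha> + p + q = s")
    case True
    have "sum ?f ?A = sum ?f {(?c s 1, ?c s n)}"
      using nz add True by (intro sum.mono_neutral_right finite_splits) auto
    then show ?thesis using True by (simp add: cmult_def lookup_C_alpha)
  next
    case False
    have "sum ?f ?A = 0" using nz False by (intro sum.neutral) blast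
    then show ?thesis using False by (simp add: cmult_def)
  qed
qed

text \<open>The residue attaches \<open>c\<^sub>\<alpha>\<^sub>+\<^sub>p\<^sub>+\<^sub>q\<close> to the fermions with field exponents \<open>p\<close> and \<open>q\<close>. Only the summands \<open>p + q = s - \<alpha>\<close> of the residue contribute to pure powers of \<open>c\<^sub>s\<close>, which
  leaves a sum over the position \<open>q\<close> of the removed factor of component \<open>e\<^sub>0\<close>.\<close>
lemma lookup_res_op_single:
  fixes Z :: "int set"
  assumes Z: "finite Z"
    and supp: "\<And>q. (1, q - 1 - (s - \<alpha>)) \<in> factors W \<Longrightarrow> (0, q) \<notin> factors W \<Longrightarrow> q \<in> Z"
  shows "lookup (res_op \<alpha> v (Poly_Mapping.single s (Suc n))) W = (-1) powi \<alpha> *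
    (\<Sum>q\<in>Z. lookup (wedging (1, q - 1 - (s - \<alpha>)) (contraction (0, q)
        (v (Poly_Mapping.single s n)))) W)"
proof -
  let ?m = "Poly_Mapping.single s (Suc n) :: monom" and ?u = "v (Poly_Mapping.single s n)"
  let ?t = "\<lambda>(p, q). cmult (C_alpha \<alpha> (- 1 - p - q))
      (\<lambda>m'. psip_field 1 p (psim_field 0 q (v m'))) ?m"
  have t: "?t (p, q) = (if \<alpha> + p + q = s then scale ((-1) powi \<alpha>)
      (wedging (1, - p - 1) (contraction (0, q) ?u)) else 0)" for p q
    unfolding prod.case cmult_C_alpha_single fields_modes ..
  let ?A = "{x. ?t x \<noteq> 0}" and ?B = "(\<lambda>q. (s - \<alpha> - q, q)) ` Z"
  have fin: "finite ?A"
    using res_op_finite[of \<alpha> v ?m] by (rule back_subst[of finite]) auto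
  have "lookup (res_op \<alpha> v ?m) W = (\<Sum>x\<in>?A. lookup (?t x) W)"
    unfolding res_op_def Sum_any.expand_set lookup_sum ..
  also have "\<dots> = (\<Sum>x\<in>?A \<union> ?B. lookup (?t x) W)"
    using fin Z by (intro sum.mono_neutral_left) auto
  also have "\<dots> = (\<Sum>x\<in>?B. lookup (?t x) W)"
  proof (rule sum.mono_neutral_right)
    show "\<forall>x\<in>?A \<union> ?B - ?B. lookup (?t x) W = 0"
    proof
      fix x assume x: "x \<in> ?A \<union> ?B - ?B"
      obtain p q where pq: "x = (p, q)" by force
      with x have p: "p = s - \<alpha> - q" using t[of p q] by (auto split: if_splits)
      with x pq have "q \<notin> Z" by auto
      with supp[of q] have "(1, q - 1 - (s - \<alpha>)) \<notin> factors W \<or> (0, q) \<in> factors W" by blast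
      then have "lookup (wedging (1, q - 1 - (s - \<alpha>)) (contraction (0, q) ?u)) W = 0"
        by (subst lookup_wedging_contraction) auto
      moreover have "q - 1 - (s - \<alpha>) = - p - 1" using p by simp
      ultimately have "lookup (wedging (1, - p - 1) (contraction (0, q) ?u)) W = 0"
        by (simp only:)
      then show "lookup (?t x) W = 0" unfolding pq t by simp
    qed
  qed (use fin Z in auto)
  also have "\<dots> = (\<Sum>q\<in>Z. lookup (?t (s - \<alpha> - q, q)) W)"
    by (subst sum.reindex) (auto simp: inj_on_def)
  also have "\<dots> = (-1) powi \<alpha> * (\<Sum>q\<in>Z. lookup (wedging (1, q - 1 - (s - \<alpha>))
      (contraction (0, q) ?u)) W)"
    unfolding t by (simp add: sum_distrib_left algebra_simps)
  finally show ?thesis .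
qed

lemma res_op_power_homogeneous:
  "lookup ((res_op \<alpha> ^^ n) (const_series v0) m) W \<noteq> 0 \<Longrightarrow> mdeg m = n"
proof (induction n arbitrary: m W)
  case 0
  then show ?case by (auto simp: const_series_def mdeg_def split: if_splits)
next
  case (Suc n)
  then have "lookup (res_op \<alpha> ((res_op \<alpha> ^^ n) (const_series v0)) m) W \<noteq> 0" by simp
  then obtain i m' W' where "m = Poly_Mapping.single i 1 + m'"
    "lookup ((res_op \<alpha> ^^ n) (const_series v0) m') W' \<noteq> 0"
    by (rule res_op_nonzeroD)
  with Suc.IH show ?case using mdeg_single_add by simp
qed

text \<open>The exponent of the exponential is linear in the \<open>c\<^sub>i\<close>, so a monomial sees only the power
  given by its degree.\<close>
lemma g_op_const_series:
  "g_op \<alpha> (const_series v0) m =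
     scale (1 / fact (mdeg m)) ((res_op \<alpha> ^^ mdeg m) (const_series v0) m)"
proof -
  let ?f = "\<lambda>n. scale (1 / fact n) ((res_op \<alpha> ^^ n) (const_series v0) m)"
  have z: "?f n = 0" if "n \<noteq> mdeg m" for n
  proof (rule poly_mapping_eqI)
    fix W
    have "lookup ((res_op \<alpha> ^^ n) (const_series v0) m) W = 0"
      using that res_op_power_homogeneous by metis
    then show "lookup (?f n) W = lookup 0 W" by simp
  qed
  have "Sum_any ?f = sum ?f {mdeg m}"
    by (rule Sum_any.expand_superset) (use z in auto)
  then show ?thesis by (simp add: g_op_def)
qed

section \<open>The \<open>\<tau>\<close>-functions with small index\<close>

text \<open>For \<open>k < 0\<close> the wedge of \<open>T\<^sup>k v\<^sub>0\<close> contains \<open>e\<^sub>0z\<^sup>k\<close>, whereas no power of the residue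
  creates factors of component \<open>e\<^sub>0\<close>.\<close>
lemma tau_neg:
  assumes "k < 0"
  shows "tau \<alpha> k = 0"
proof (rule poly_mapping_eqI)
  fix m
  have "(0, k) \<in> charged_modes k" by (simp add: charged_modes_def)
  then have "lookup ((res_op \<alpha> ^^ n) (const_series v0) m) (Wedge (charged_modes k)) = 0" for n
    using res_op_power_v0[of n \<alpha> m "Wedge (charged_modes k)"] assms by auto
  then show "lookup (tau \<alpha> k) m = lookup 0 m"
    using lookup_tau_charged[of \<alpha> k m] by (simp add: g_op_const_series)
qed

lemma tau_0: "tau \<alpha> 0 = 1"
proof (rule poly_mapping_eqI)
  fix m
  have l: "lookup (tau \<alpha> 0) m = lookup (g_op \<alpha> (const_series v0) m) (Wedge vac_modes)"
    by (simp add: lookup_tau iterate_int_def v0_bw pairing_bw_left)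
  show "lookup (tau \<alpha> 0) m = lookup 1 m"
  proof (cases "m = 0")
    case True
    have "g_op \<alpha> (const_series v0) 0 = v0"
      unfolding g_op_const_series by (simp add: mdeg_def const_series_def)
    with True show ?thesis unfolding l by (simp add: v0_def lookup_basis)
  next
    case False
    have "wD (Wedge vac_modes) = {}"
      unfolding wD_def factors_Wedge[OF adm_vac] by (auto simp: vac_modes_def)
    with False have "lookup ((res_op \<alpha> ^^ n) (const_series v0) m) (Wedge vac_modes) = 0" for n
      using res_op_power_v0[of n \<alpha> m "Wedge vac_modes"] by (auto simp: keys_eq_empty)
    with False show ?thesis unfolding l by (simp add: g_op_const_series lookup_one)
  qed
qed

section \<open>Nonvanishing of the \<open>\<tau>\<close>-functions\<close>

text \<open>The factors of the vacuum after the exchanges of \<open>e\<^sub>0z\<^sup>q\<close> for \<open>e\<^sub>1z\<^sup>q\<^sup>-\<^sup>k\<close> with \<open>q \<in> U\<close>\<close>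
definition moved_modes :: "int \<Rightarrow> int set \<Rightarrow> mode set" where
  "moved_modes k U = (vac_modes - Pair 0 ` U) \<union> (\<lambda>q. (1, q - k)) ` U"

lemma moved_modes_iff [simp]:
  "(0, j) \<in> moved_modes k U \<longleftrightarrow> 0 \<le> j \<and> j \<notin> U"
  "(1, j) \<in> moved_modes k U \<longleftrightarrow> 0 \<le> j \<or> j + k \<in> U"
  by (auto simp: moved_modes_def vac_modes_def image_iff algebra_simps)

lemma adm_moved_modes [simp]: 
  assumes "finite U"
  shows "adm (moved_modes k U)"
proof -
  have "sym_diff (moved_modes k U) vac_modes \<subseteq> Pair 0 ` U \<union> (\<lambda>q. (1, q - k)) ` U"
    by (auto simp: moved_modes_def)
  then show ?thesis unfolding adm_def using assms finite_subset by blast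
qed

lemma moved_modes_all:
  assumes "0 \<le> k"
  shows "moved_modes k {0..<k} = charged_modes k"
proof (rule set_eqI)
  fix x :: mode
  show "x \<in> moved_modes k {0..<k} \<longleftrightarrow> x \<in> charged_modes k"
    using mode_ex[of x] assms by (auto simp: charged_modes_def)
qed

lemma moved_modes_remove:
  assumes "U \<subseteq> {0..<k}" "q \<in> U"
  shows "insert (0, q) (moved_modes k U - {(1, q - k)}) = moved_modes k (U - {q})"
proof (rule set_eqI)
  fix x :: mode
  show "x \<in> insert (0, q) (moved_modes k U - {(1, q - k)}) \<longleftrightarrow> x \<in> moved_modes k (U - {q})"
    using mode_ex[of x] assms by auto
qed

text \<open>The sign of the exchange at \<open>q\<close> depends on the number of earlier exchanges only. The factor
  \<open>e\<^sub>1z\<^sup>q\<^sup>-\<^sup>k\<close> passes the \<open>e\<^sub>1z\<^sup>j\<^sup>-\<^sup>k\<close> with \<open>j \<in> U\<close>, \<open>j < q\<close>. The factor \<open>e\<^sub>0z\<^sup>q\<close> passes all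
  \<open>e\<^sub>1z\<^sup>j\<^sup>-\<^sup>k\<close> with \<open>j \<in> U\<close>, \<open>j \<noteq> q\<close>, and, for \<open>0 \<le> j < q\<close>, every \<open>e\<^sub>1z\<^sup>j\<close> and those
  \<open>e\<^sub>0z\<^sup>j\<close> with \<open>j \<notin> U\<close>. The \<open>j < q\<close> in \<open>U\<close> and those outside \<open>U\<close> add up to \<open>q\<close>, which
  cancels modulo \<open>2\<close> against the \<open>q\<close> factors \<open>e\<^sub>1z\<^sup>j\<close>.\<close>
lemma wsign_moved_modes:
  assumes U: "U \<subseteq> {0..<k}" and q: "q \<in> U"
  defines "S \<equiv> moved_modes k U - {(1, q - k)}"
  shows "wsign (1, q - k) S * wsign (0, q) S = (-1) ^ (card U - 1)"
proof -
  have finU: "finite U" using U finite_subset by blast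
  have q0: "0 \<le> q" "q < k" using U q by auto
  have S: "adm S" using finU by (simp add: S_def)
  let ?x = "{s \<in> S. mode_pos s < mode_pos (1, q - k)}"
  let ?y = "{s \<in> S. mode_pos s < mode_pos (0, q)}"
  define G where "G = {j \<in> U. q < j}"
  define L where "L = {j \<in> U. j < q}"
  have fin: "finite G" "finite L" using finU by (simp_all add: G_def L_def)
  have GL: "G \<union> L = U - {q}" by (auto simp: G_def L_def)
  have im: "(1, j) \<in> (\<lambda>i. (1::bit, i - k)) ` X \<longleftrightarrow> j + k \<in> X" for j X
    by (auto simp: image_iff intro!: bexI[of _ "j + k"])
  have x: "?x = (\<lambda>j. (1, j - k)) ` L" (is "_ = ?xL")
  proof (rule set_eqI)
    fix s :: mode
    show "s \<in> ?x \<longleftrightarrow> s \<in> ?xL"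
      using mode_ex[of s] U q0 by (auto simp: S_def L_def mode_pos_def im)
  qed
  have y: "?y = ((\<lambda>j. (1, j - k)) ` (G \<union> L) \<union> Pair 1 ` {0..<q}) \<union> Pair 0 ` ({0..<q} - L)"
    (is "_ = ?yR")
  proof (rule set_eqI)
    fix s :: mode
    show "s \<in> ?y \<longleftrightarrow> s \<in> ?yR"
      unfolding GL using mode_ex[of s] U q0 by (auto simp: S_def L_def mode_pos_def im)
  qed
  have cx: "card ?x = card L" unfolding x by (subst card_image) (auto simp: inj_on_def)
  have cy: "card ?y = card (U - {q}) + nat q + card ({0..<q} - L)"
  proof -
    have "card ?y = card ((\<lambda>j. (1::bit, j - k)) ` (U - {q})) + card (Pair (1::bit) ` {0..<q})
        + card (Pair (0::bit) ` ({0..<q} - L))"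
      unfolding y GL using finU U
      by (subst card_Un_disjoint, simp, simp, force)+ simp
    also have "\<dots> = card (U - {q}) + nat q + card ({0..<q} - L)"
      by (subst (1 2 3) card_image) (auto simp: inj_on_def)
    finally show ?thesis .
  qed
  have "L \<subseteq> {0..<q}" using U by (auto simp: L_def)
  then have "card ({0..<q} - L) + card L = nat q"
    using card_mono[of "{0..<q}" L] fin by (subst card_Diff_subset) auto
  then have "card ?x + card ?y = card U - 1 + 2 * nat q"
    using cx cy finU q by simp
  then show ?thesis
    unfolding wsign_def power_add[symmetric] by (simp add: power_add power_mult)
qed

text \<open>The last of the exchanges may be at any \<open>q \<in> U\<close>. By \<open>wsign_moved_modes\<close> each choice carries
  the sign \<open>(- 1)\<^sup>n\<close>, where \<open>n\<close> exchanges precede it, so the coefficients for \<open>U - {q}\<close> add up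
  without cancellation.\<close>
lemma lookup_res_op_power:
  assumes "U \<subseteq> {0..<k}"
  shows "lookup ((res_op \<alpha> ^^ card U) (const_series v0)
      (Poly_Mapping.single (\<alpha> + k - 1) (card U))) (Wedge (moved_modes k U))
    = ((-1) powi \<alpha>) ^ card U * (-1) ^ (card U choose 2) * fact (card U)"
  using assms
proof (induction "card U" arbitrary: U)
  case 0
  then have "U = {}" using finite_subset[of U] by auto
  moreover have "moved_modes k {} = vac_modes" by (simp add: moved_modes_def)
  ultimately show ?case by (simp add: const_series_def v0_def lookup_basis binomial_eq_0)
next
  case (Suc n)
  note c = Suc.hyps(2)[symmetric]
  have finU: "finite U" using Suc.prems finite_subset by blast
  have k: "0 < k" using c Suc.prems by (cases "U = {}") auto
  let ?s = "\<alpha> + k - 1" and ?W = "Wedge (moved_modes k U)"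
  let ?u = "(res_op \<alpha> ^^ n) (const_series v0) (Poly_Mapping.single ?s n)"
  let ?e = "((-1) powi \<alpha>) ^ n * (-1) ^ (n choose 2) * fact n :: complex"
  have F: "factors ?W = moved_modes k U" using finU by simp
  have s: "q - 1 - (?s - \<alpha>) = q - k" for q by simp
  have summand: "lookup (wedging (1, q - k) (contraction (0, q) ?u)) ?W = (-1) ^ n * ?e"
    if q: "q \<in> U" for q
  proof -
    have "card (U - {q}) = n" using c q finU by simp
    then have IH: "lookup ?u (Wedge (moved_modes k (U - {q}))) = ?e"
      using Suc.hyps(1)[of "U - {q}"] Suc.prems by auto
    have "(1, q - k) \<in> moved_modes k U" "(0, q) \<notin> moved_modes k U" using q by simp_all
    then have "lookup (wedging (1, q - k) (contraction (0, q) ?u)) ?W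
        = wsign (1, q - k) (moved_modes k U - {(1, q - k)})
          * wsign (0, q) (moved_modes k U - {(1, q - k)})
          * lookup ?u (Wedge (moved_modes k (U - {q})))"
      by (subst lookup_wedging_contraction)
        (simp_all add: F moved_modes_remove[OF Suc.prems q] del: moved_modes_iff)
    also have "\<dots> = (-1) ^ n * ?e"
      unfolding wsign_moved_modes[OF Suc.prems q] IH c by simp
    finally show ?thesis .
  qed
  have "lookup (res_op \<alpha> ((res_op \<alpha> ^^ n) (const_series v0)) (Poly_Mapping.single ?s (Suc n))) ?W
      = (-1) powi \<alpha> * (\<Sum>q\<in>U. lookup (wedging (1, q - k) (contraction (0, q) ?u)) ?W)"
    by (subst lookup_res_op_single[OF finU]) (use Suc.prems k in \<open>auto simp: F s\<close>)
  also have "\<dots> = (-1) powi \<alpha> * (of_nat (Suc n) * ((-1) ^ n * ?e))"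
    using summand c by simp
  also have "\<dots> = ((-1) powi \<alpha>) ^ Suc n * (-1) ^ (Suc n choose 2) * fact (Suc n)"
    by (simp add: numeral_2_eq_2 power_add algebra_simps)
  finally show ?case unfolding c by simp
qed

text \<open>The coefficient of \<open>c\<^sub>\<alpha>\<^sub>+\<^sub>k\<^sub>-\<^sub>1\<^sup>k\<close> is \<open>\<plusminus>1\<close>: the factor \<open>k!\<close> from the orders of the exchanges
  cancels against the one in the exponential series.\<close>
lemma tau_nonzero:
  assumes "0 \<le> k"
  shows "tau \<alpha> k \<noteq> 0"
proof
  assume z: "tau \<alpha> k = 0"
  let ?n = "card {0..<k}"
  let ?m = "Poly_Mapping.single (\<alpha> + k - 1) ?n :: monom"
  have deg: "mdeg ?m = ?n" by (simp add: mdeg_def)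
  have "lookup ((res_op \<alpha> ^^ ?n) (const_series v0) ?m) (Wedge (charged_modes k)) \<noteq> 0"
    using lookup_res_op_power[of "{0..<k}" k \<alpha>] unfolding moved_modes_all[OF assms] by simp
  then have "lookup (tau \<alpha> k) ?m \<noteq> 0"
    using lookup_tau_charged[of \<alpha> k ?m] unfolding g_op_const_series deg by auto
  with z show False by simp
qed

section \<open>The two systems of equations\<close>

text \<open>The letters abbreviate values of \<open>\<tau>\<close>: \<open>a\<close>, \<open>b\<close> are those at \<open>\<alpha>\<close> with indices \<open>k\<close>,
  \<open>k + 1\<close>; \<open>p0\<close>, \<open>p1\<close>, \<open>p2\<close> those at \<open>\<alpha> + 1\<close> with indices \<open>k - 1\<close>, \<open>k\<close>, \<open>k + 1\<close>;
  \<open>m1\<close>, \<open>m2\<close>, \<open>m3\<close> those at \<open>\<alpha> - 1\<close> with indices \<open>k\<close>, \<open>k + 1\<close>, \<open>k + 2\<close>. After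
  multiplication with the denominators the ratio equation has the terms of the defect equation, with
  \<open>m2 p0 b\<^sup>2\<close> and \<open>m3 p1 a\<^sup>2\<close> on the other side; the terms \<open>a\<^sup>2 b\<^sup>2\<close> of the two defects
  cancel.\<close>
lemma ratio_equation_iff_defects:
  fixes a :: "'a :: field"
  assumes nz: "a \<noteq> 0" "b \<noteq> 0" "p1 \<noteq> 0" "p2 \<noteq> 0" "m1 \<noteq> 0" "m2 \<noteq> 0"
  shows "b / a * (p0 / p1) + p2 / p1 / (b / a) = m3 / m2 / (b / a) + b / a / (m2 / m1)
    \<longleftrightarrow> (m1 * p1 - m2 * p0 - a\<^sup>2) * b\<^sup>2 = (m2 * p2 - m3 * p1 - b\<^sup>2) * a\<^sup>2"
proof -
  have "b / a * (p0 / p1) + p2 / p1 / (b / a) = (b\<^sup>2 * p0 + p2 * a\<^sup>2) / (a * b * p1)"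
    using nz by (simp add: field_simps power2_eq_square)
  moreover have "m3 / m2 / (b / a) + b / a / (m2 / m1) = (m3 * a\<^sup>2 + b\<^sup>2 * m1) / (a * b * m2)"
    using nz by (simp add: field_simps power2_eq_square)
  moreover have "(b\<^sup>2 * p0 + p2 * a\<^sup>2) / (a * b * p1) = (m3 * a\<^sup>2 + b\<^sup>2 * m1) / (a * b * m2)
      \<longleftrightarrow> (b\<^sup>2 * p0 + p2 * a\<^sup>2) * m2 = (m3 * a\<^sup>2 + b\<^sup>2 * m1) * p1"
    using nz frac_eq_eq[of "a * b * p1" "a * b * m2"] by (simp add: mult_ac)
  moreover have "\<dots> \<longleftrightarrow> (m1 * p1 - m2 * p0 - a\<^sup>2) * b\<^sup>2 = (m2 * p2 - m3 * p1 - b\<^sup>2) * a\<^sup>2"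
    by (auto simp: algebra_simps power2_eq_square)
  ultimately show ?thesis by simp
qed

lemma ratio_system_iff_Q_system:
  fixes t :: "int \<Rightarrow> int \<Rightarrow> 'a :: field"
  assumes nz: "\<And>\<alpha> k. 0 \<le> k \<Longrightarrow> t \<alpha> k \<noteq> 0"
    and t0: "\<And>\<alpha>. t \<alpha> 0 = 1" and tm: "\<And>\<alpha>. t \<alpha> (- 1) = 0"
  defines "r \<equiv> \<lambda>\<alpha> k. t \<alpha> (k + 1) / t \<alpha> k"
  shows "(\<forall>\<alpha> k. 0 \<le> k \<longrightarrow> r \<alpha> k * (t (\<alpha> + 1) (k - 1) / t (\<alpha> + 1) k) + r (\<alpha> + 1) k / r \<alpha> k
        = r (\<alpha> - 1) (k + 1) / r \<alpha> k + r \<alpha> k / r (\<alpha> - 1) k)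
    \<longleftrightarrow> (\<forall>\<alpha> k. 0 \<le> k \<longrightarrow> (t \<alpha> k)\<^sup>2
        = t (\<alpha> - 1) k * t (\<alpha> + 1) k - t (\<alpha> - 1) (k + 1) * t (\<alpha> + 1) (k - 1))"
proof -
  define D where "D \<alpha> k = t (\<alpha> - 1) k * t (\<alpha> + 1) k
      - t (\<alpha> - 1) (k + 1) * t (\<alpha> + 1) (k - 1) - (t \<alpha> k)\<^sup>2" for \<alpha> k
  have ratio: "r \<alpha> k * (t (\<alpha> + 1) (k - 1) / t (\<alpha> + 1) k) + r (\<alpha> + 1) k / r \<alpha> k
        = r (\<alpha> - 1) (k + 1) / r \<alpha> k + r \<alpha> k / r (\<alpha> - 1) k
      \<longleftrightarrow> D \<alpha> k * (t \<alpha> (k + 1))\<^sup>2 = D \<alpha> (k + 1) * (t \<alpha> k)\<^sup>2" if "0 \<le> k" for \<alpha> k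
    unfolding r_def D_def add_diff_cancel_right'
    by (rule ratio_equation_iff_defects) (use that nz in auto)
  have Q: "(t \<alpha> k)\<^sup>2 = t (\<alpha> - 1) k * t (\<alpha> + 1) k - t (\<alpha> - 1) (k + 1) * t (\<alpha> + 1) (k - 1)
      \<longleftrightarrow> D \<alpha> k = 0" for \<alpha> k
    unfolding D_def by auto
  have "D \<alpha> k = 0"
    if rec: "\<And>\<alpha> k. 0 \<le> k \<Longrightarrow> D \<alpha> k * (t \<alpha> (k + 1))\<^sup>2 = D \<alpha> (k + 1) * (t \<alpha> k)\<^sup>2" and "0 \<le> k"
    for \<alpha> k
    using \<open>0 \<le> k\<close>
  proof (induction k rule: int_ge_induct)
    case base
    show ?case by (simp add: D_def t0 tm)
  next
    case (step k)
    then show ?case using rec[of k \<alpha>] nz[of k \<alpha>] by simp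
  qed
  moreover have "D \<alpha> k * (t \<alpha> (k + 1))\<^sup>2 = D \<alpha> (k + 1) * (t \<alpha> k)\<^sup>2"
    if "\<And>\<alpha> k. 0 \<le> k \<Longrightarrow> D \<alpha> k = 0" and "0 \<le> k" for \<alpha> k
    using that by simp
  ultimately have "(\<forall>\<alpha> k. 0 \<le> k \<longrightarrow> D \<alpha> k * (t \<alpha> (k + 1))\<^sup>2 = D \<alpha> (k + 1) * (t \<alpha> k)\<^sup>2)
      \<longleftrightarrow> (\<forall>\<alpha> k. 0 \<le> k \<longrightarrow> D \<alpha> k = 0)"
    by blast
  then show ?thesis by (simp only: ratio Q cong: imp_cong)
qed

theorem theorem2p7:
  shows "(\<forall>(\<alpha>::int) (k::int). 0 \<le> k \<longrightarrow>
            h_ratio \<alpha> k * inv_h_ratio (\<alpha> + 1) (k - 1) + h_ratio (\<alpha> + 1) k / h_ratio \<alpha> k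
          = h_ratio (\<alpha> - 1) (k + 1) / h_ratio \<alpha> k + h_ratio \<alpha> k / h_ratio (\<alpha> - 1) k)
     \<longleftrightarrow>
         (\<forall>(\<alpha>::int) (k::int). 0 \<le> k \<longrightarrow>
            (tau \<alpha> k)\<^sup>2
          = tau (\<alpha> - 1) k * tau (\<alpha> + 1) k - tau (\<alpha> - 1) (k + 1) * tau (\<alpha> + 1) (k - 1))"
proof -
  define t :: "int \<Rightarrow> int \<Rightarrow> cpoly fract" where "t \<alpha> k = Fract (tau \<alpha> k) 1" for \<alpha> k
  have nz: "t \<alpha> k \<noteq> 0" if "0 \<le> k" for \<alpha> k
    using tau_nonzero[OF that, of \<alpha>] by (simp add: t_def Zero_fract_def eq_fract)
  have t0: "t \<alpha> 0 = 1" and tm: "t \<alpha> (- 1) = 0" for \<alpha>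
    by (simp_all add: t_def tau_0 tau_neg One_fract_def Zero_fract_def)
  have h: "h_ratio \<alpha> k = t \<alpha> (k + 1) / t \<alpha> k" for \<alpha> k
    by (simp add: h_ratio_def t_def divide_fract)
  have ih: "inv_h_ratio \<alpha> (k - 1) = t \<alpha> (k - 1) / t \<alpha> k" if "0 \<le> k" for \<alpha> k
    using that tm by (auto simp: inv_h_ratio_def h)
  have Q: "(tau \<alpha> k)\<^sup>2 = tau (\<alpha> - 1) k * tau (\<alpha> + 1) k - tau (\<alpha> - 1) (k + 1) * tau (\<alpha> + 1) (k - 1)
      \<longleftrightarrow> (t \<alpha> k)\<^sup>2 = t (\<alpha> - 1) k * t (\<alpha> + 1) k - t (\<alpha> - 1) (k + 1) * t (\<alpha> + 1) (k - 1)" for \<alpha> k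
    by (simp add: t_def power2_eq_square eq_fract)
  show ?thesis
    using ratio_system_iff_Q_system[of t, OF nz t0 tm, folded h]
    by (simp only: Q ih cong: imp_cong)
qed

end
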